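(* Let $G,H$ be graphs and $r\geq 2$ an integer such that $G \to_r H$. Then there exist constants $a=a(G,H,r)$ and $b=b(H,r)$ (i.e. $b$ depends only on $H$ and $r$) such that for every positive integer $t$, \[ \mathrm{B}_r(G \to H;t) \leq a \cdot b^t. \] Moreover, for every $\gamma>0$ sufficiently small with respect to $r$, one may take $b=r^{(r+\gamma)^{|E(H)|-1}}$, provided $a$ is chosen sufficiently large with respect to $\gamma$ (and $G,H,r$).
   Context: For graphs $G,H$ and an integer $r$, write $G\to_r H$ if every $r$-edge-coloring of $G$ contains a monochromatic copy of $H$. For a graph $H$ and a positive integer $t$, the $t$-blowup $H[t]$ is the graph obtained from $H$ by replacing every vertex by an independent set of size $t$ and every edge by a complete bipartite graph $K_{t,t}$ between the corresponding sets. A copy of $H[t]$ in $G[n]$ is called canonical if it is the $t$-blowup of a copy of $H$ in $G$, i.e. there is a copy of $H$ in $G$ such that for each vertex $v$ of this copy, the $t$ vertices of $H[t]$ corresponding to $v$ lie in the independent set of $G[n]$ replacing $v$. For $G\to_r H$ and a positive integer $t$, the blowup Ramsey number $\mathrm{B}_r(G\to H;t)$ is the minimum $n$ such that every $r$-edge-coloring of $G[n]$ contains a monochromatic canonical copy of $H[t]$. *)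

theory Defs
  imports Complex_Main "HOL-Library.Extended_Nat" "HOL-Library.Extended_Real"
begin

record 'a ugraph =
  verts :: "'a set"
  edges :: "'a set set"

definition simple_graph :: "'a ugraph \<Rightarrow> bool" where
  "simple_graph G \<longleftrightarrow>
     finite (verts G) \<and> (\<forall>e\<in>edges G. e \<subseteq> verts G \<and> card e = 2)"

text \<open>A (not necessarily induced) copy of \<open>H\<close> in \<open>G\<close> is given by an injective
  edge-preserving map.\<close>

definition copy_of :: "('b \<Rightarrow> 'a) \<Rightarrow> 'b ugraph \<Rightarrow> 'a ugraph \<Rightarrow> bool" where
  "copy_of \<phi> H G \<longleftrightarrow>
     inj_on \<phi> (verts H) \<and> \<phi> ` verts H \<subseteq> verts G \<and> (\<forall>e\<in>edges H. \<phi> ` e \<in> edges G)"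

definition edge_coloring :: "nat \<Rightarrow> 'a ugraph \<Rightarrow> ('a set \<Rightarrow> nat) \<Rightarrow> bool" where
  "edge_coloring r G c \<longleftrightarrow> (\<forall>e\<in>edges G. c e < r)"

definition monochromatic :: "('a set \<Rightarrow> nat) \<Rightarrow> ('b \<Rightarrow> 'a) \<Rightarrow> 'b ugraph \<Rightarrow> bool" where
  "monochromatic c \<phi> H \<longleftrightarrow> (\<exists>k. \<forall>e\<in>edges H. c (\<phi> ` e) = k)"

definition arrows :: "nat \<Rightarrow> 'a ugraph \<Rightarrow> 'b ugraph \<Rightarrow> bool" where
  "arrows r G H \<longleftrightarrow>
     (\<forall>c. edge_coloring r G c \<longrightarrow> (\<exists>\<phi>. copy_of \<phi> H G \<and> monochromatic c \<phi> H))"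

definition blowup :: "'a ugraph \<Rightarrow> nat \<Rightarrow> ('a \<times> nat) ugraph" where
  "blowup H t =
     \<lparr> verts = verts H \<times> {..<t},
       edges = {{(u, i), (v, j)} | u v i j. {u, v} \<in> edges H \<and> i < t \<and> j < t} \<rparr>"

definition canonical_copy ::
    "('b \<times> nat \<Rightarrow> 'a \<times> nat) \<Rightarrow> 'b ugraph \<Rightarrow> nat \<Rightarrow> 'a ugraph \<Rightarrow> nat \<Rightarrow> bool" where
  "canonical_copy \<psi> H t G n \<longleftrightarrow>
     copy_of \<psi> (blowup H t) (blowup G n) \<and>
     (\<exists>\<phi>. copy_of \<phi> H G \<and> (\<forall>v\<in>verts H. \<forall>i<t. fst (\<psi> (v, i)) = \<phi> v))"

text \<open>The infimum in \<^typ>\<open>enat\<close> is the minimum if an admissible \<open>n\<close> exists and is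
  \<open>\<infinity>\<close> otherwise; hence a finite upper bound on it includes the existence of such an \<open>n\<close>.\<close>

definition blowup_ramsey :: "nat \<Rightarrow> 'a ugraph \<Rightarrow> 'b ugraph \<Rightarrow> nat \<Rightarrow> enat" where
  "blowup_ramsey r G H t =
     Inf {enat n | n. n \<ge> 1 \<and>
       (\<forall>c. edge_coloring r (blowup G n) c \<longrightarrow>
          (\<exists>\<psi>. canonical_copy \<psi> H t G n \<and> monochromatic c \<psi> (blowup H t)))}"

end

theory Submission
  imports Defs
begin

text \<open>
  If \<open>H\<close> has at least two edges, each pair of parts of the coloured blowup of \<open>G\<close> contains a pair of
  linear-sized subsets on which some colour has density at least about \<open>1 / r\<close> between any two large
  subsets. These popular colours form an \<open>r\<close>-colouring of \<open>G\<close>, so \<open>G \<rightarrow>\<^sub>r H\<close> yields a copy of \<open>H\<close>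
  all of whose pairs are dense in one colour. In it one embeds \<open>s\<close> copies of \<open>H\<close>, vertex by vertex,
  starting with a biclique on the first edge. At each further vertex with \<open>d\<close> earlier neighbours the
  pigeonhole principle over the \<open>2 ^ s\<close> sets of indices keeps a proportion of about \<open>r ^ (-d)\<close> of the
  copies, and the surviving copies are pairwise compatible. Hence \<open>s \<approx> t r ^ (|E(H)| - 1)\<close> and parts of
  size about \<open>r ^ s\<close> suffice.

  If \<open>H\<close> has one edge, there is no slack in \<open>b = r\<close>: a bipartite graph of density \<open>p\<close> with sides of
  order \<open>p ^ (-t)\<close>, without a factor growing with \<open>t\<close>, has to contain \<open>K\<^sub>t\<^sub>,\<^sub>t\<close>. This is achieved by
  repeatedly choosing most of the vertices needed on one side and passing to their common
  neighbourhood, with summable relative losses.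
\<close>

subsection \<open>Bicliques in dense bipartite graphs\<close>

text \<open>Two demands compete for the size of the parts: a biclique with \<open>s\<close> vertices
  on each side in density about \<open>1 / r\<close> asks for about \<open>r ^ s\<close> vertices,
  the pigeonhole over index sets for about \<open>2 ^ s\<close>. Since \<open>r \<ge> 2\<close>, the
  first dominates, so embedding further vertices of \<open>H\<close> enlarges \<open>s\<close> but
  not the base \<open>r\<close>.

  The graph \<open>G\<close> enters only through the passage to regular subsets, which are refined
  once for every edge of \<open>G\<close>. This shrinks the parts by a factor that does not depend
  on \<open>t\<close>, so it affects \<open>a\<close> and not \<open>b\<close>.

  The factors \<open>1 - \<eta>\<close> and the polynomials in \<open>s\<close> are paid for by
  \<gamma>, because \<open>(r + \<gamma>) ^ (|E(H)| - 1)\<close> strictly exceeds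
  \<open>r ^ (|E(H)| - 1)\<close> when \<open>|E(H)| \<ge> 2\<close>. For one edge the exponent is 0
  and \<gamma> disappears, so the biclique bound has to be exact up to a constant.\<close>

definition edge_count :: "('a \<Rightarrow> 'b \<Rightarrow> bool) \<Rightarrow> 'a set \<Rightarrow> 'b set \<Rightarrow> real" where
  "edge_count E X Y = (\<Sum>x\<in>X. \<Sum>y\<in>Y. of_bool (E x y))"

lemma edge_count_swap: "edge_count (\<lambda>y x. E x y) Y X = edge_count E X Y"
  unfolding edge_count_def by (rule sum.swap)

lemma edge_count_eq_sum_card:
  assumes "finite X"
  shows "edge_count E X Y = (\<Sum>y\<in>Y. real (card {x\<in>X. E x y}))"
proof -
  have "(\<Sum>x\<in>X. of_bool (E x y)) = real (card {x\<in>X. E x y})" for y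
    using assms by (simp add: Int_def)
  then show ?thesis
    unfolding edge_count_def by (subst sum.swap) simp
qed

section \<open>Convexity of powers and falling factorials\<close>

text \<open>Multiplying the inequality for one exponent by \<open>x\<close> overshoots the next one
  by a nonnegative multiple of \<open>(x - a)^2\<close>, so convexity follows by induction without
  derivatives.\<close>

lemma power_tangent_le:
  fixes x a :: real
  assumes "0 \<le> x" "0 \<le> a"
  shows "a ^ Suc k + real (Suc k) * a ^ k * (x - a) \<le> x ^ Suc k"
proof (induction k)
  case (Suc k)
  have "a ^ Suc (Suc k) + real (Suc (Suc k)) * a ^ Suc k * (x - a)
      = x * (a ^ Suc k + real (Suc k) * a ^ k * (x - a)) - real (Suc k) * a ^ k * (x - a)\<^sup>2"
    by (simp add: algebra_simps power2_eq_square)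
  also have "\<dots> \<le> x * (a ^ Suc k + real (Suc k) * a ^ k * (x - a))"
    using assms by simp
  also have "\<dots> \<le> x * x ^ Suc k"
    using Suc assms by (intro mult_left_mono) auto
  finally show ?case by simp
qed simp

text \<open>Jensen's inequality for powers. The tangent is taken at the lower bound
  \<open>a\<close>, so the mean need not be known exactly.\<close>

lemma sum_power_ge:
  fixes f :: "'a \<Rightarrow> real" and a :: real
  assumes "\<And>y. y \<in> Y \<Longrightarrow> 0 \<le> f y" "0 \<le> a" "a * card Y \<le> (\<Sum>y\<in>Y. f y)"
  shows "card Y * a ^ k \<le> (\<Sum>y\<in>Y. f y ^ k)"
proof (cases k)
  case (Suc j)
  have "card Y * a ^ Suc j \<le> card Y * a ^ Suc j + real (Suc j) * a ^ j * ((\<Sum>y\<in>Y. f y) - a * card Y)"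
    using assms by simp
  also have "\<dots> = (\<Sum>y\<in>Y. a ^ Suc j + real (Suc j) * a ^ j * (f y - a))"
    by (simp add: sum.distrib sum_subtractf flip: sum_distrib_left)
  also have "\<dots> \<le> (\<Sum>y\<in>Y. f y ^ Suc j)"
    using assms by (intro sum_mono power_tangent_le) auto
  finally show ?thesis using Suc by simp
qed simp

text \<open>The left factor times the binomial is a falling factorial, whose factors lie between
  \<open>d - k\<close> and \<open>d\<close>. With \<open>fact_binomial_le\<close> this converts
  between numbers of \<open>k\<close>-subsets and \<open>k\<close>-th powers.\<close>

lemma fact_binomial_ge:
  assumes "k \<le> d"
  shows "(real d - real k) ^ k \<le> fact k * real (d choose k)"
proof -
  have "fact k * real (d choose k) = (\<Prod>i = 0..<k. real d - real i)"
    by (simp add: binomial_gbinomial gbinomial_mult_fact)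
  moreover have "(\<Prod>i = 0..<k. real d - real k) \<le> (\<Prod>i = 0..<k. real d - real i)"
    using assms by (intro prod_mono) auto
  ultimately show ?thesis by simp
qed

lemma fact_binomial_le: "fact k * real (d choose k) \<le> real d ^ k"
proof (cases "k \<le> d")
  case True
  have "fact k * real (d choose k) = (\<Prod>i = 0..<k. real d - real i)"
    by (simp add: binomial_gbinomial gbinomial_mult_fact)
  moreover have "(\<Prod>i = 0..<k. real d - real i) \<le> (\<Prod>i = 0..<k. real d)"
    using True by (intro prod_mono) auto
  ultimately show ?thesis by simp
qed (simp add: binomial_eq_0)

section \<open>Sampling a common neighbourhood\<close>

text \<open>Double counting of the pairs \<open>(S, y)\<close> in which \<open>S\<close> is a
  \<open>k\<close>-subset of the neighbourhood of \<open>y\<close>.\<close>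

lemma sum_card_common_neighbours:
  assumes "finite X" "finite Y"
  shows "(\<Sum>S | S \<subseteq> X \<and> card S = k. card {y\<in>Y. \<forall>x\<in>S. E x y})
       = (\<Sum>y\<in>Y. card {x\<in>X. E x y} choose k)"
proof -
  let ?P = "{S. S \<subseteq> X \<and> card S = k}"
  have finP: "finite ?P" using assms by simp
  have "(\<Sum>S\<in>?P. card {y\<in>Y. \<forall>x\<in>S. E x y}) = (\<Sum>y\<in>Y. card {S\<in>?P. \<forall>x\<in>S. E x y})"
    using finP assms(2) by (rule sum_multicount_gen) simp
  also have "\<dots> = (\<Sum>y\<in>Y. card {x\<in>X. E x y} choose k)"
  proof (rule sum.cong)
    fix y
    have "{S\<in>?P. \<forall>x\<in>S. E x y} = {S. S \<subseteq> {x\<in>X. E x y} \<and> card S = k}" by auto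
    then show "card {S\<in>?P. \<forall>x\<in>S. E x y} = card {x\<in>X. E x y} choose k"
      using assms n_subsets[of "{x\<in>X. E x y}" k] by simp
  qed simp
  finally show ?thesis .
qed

text \<open>Truncating the degrees at \<open>k + (1 - \<delta>) p' N\<close> ensures that the common neighbours of \<open>S\<close> keep
  degree at least \<open>(1 - \<delta>) p' N\<close> into \<open>X - S\<close>, so that the sampling can be iterated.\<close>

lemma common_neighbourhood_sampling:
  fixes p \<delta> :: real
  assumes fin: "finite X" "finite Y" and k: "k \<le> card X" "card X > 0"
    and dens: "p * card X * card Y \<le> edge_count E X Y"
    and p': "p' = p - k / card X" "0 \<le> p'" and \<delta>: "0 \<le> \<delta>" "\<delta> \<le> 1"
  obtains S Y' where "S \<subseteq> X" "card S = k" "Y' \<subseteq> Y"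
    "\<And>x y. x \<in> S \<Longrightarrow> y \<in> Y' \<Longrightarrow> E x y"
    "\<And>y. y \<in> Y' \<Longrightarrow> k + (1 - \<delta>) * p' * card X \<le> card {x\<in>X. E x y}"
    "p' ^ k * (1 - (1 - \<delta>) ^ k) * card Y \<le> card Y'"
proof -
  define N where "N = real (card X)"
  have N: "N > 0" using k by (simp add: N_def)
  define d where "d y = card {x\<in>X. E x y}" for y
  \<comment> \<open>The shift by \<open>k\<close> makes \<open>(N * f y) ^ k\<close> a lower bound
    for \<open>fact k * (d y choose k)\<close> on \<open>H\<close>; its price is that the mean drops
    from \<open>p\<close> to \<open>p'\<close>.\<close>
  define f where "f y = max 0 ((real (d y) - k) / N)" for y
  define H where "H = {y\<in>Y. k + (1 - \<delta>) * p' * N \<le> d y}"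
  let ?P = "{S. S \<subseteq> X \<and> card S = k}"
  have finH: "finite H" "H \<subseteq> Y" using fin by (auto simp: H_def)
  have "p' * card Y = p * N * card Y / N - (\<Sum>y\<in>Y. real k / N)"
    using N by (simp add: p' N_def[symmetric] field_simps)
  also have "\<dots> \<le> (\<Sum>y\<in>Y. real (d y)) / N - (\<Sum>y\<in>Y. real k / N)"
    using dens N edge_count_eq_sum_card[OF fin(1), of E Y]
    by (intro diff_right_mono divide_right_mono) (auto simp: d_def N_def)
  also have "\<dots> = (\<Sum>y\<in>Y. (real (d y) - k) / N)"
    by (simp add: sum_divide_distrib sum_subtractf diff_divide_distrib)
  also have "\<dots> \<le> (\<Sum>y\<in>Y. f y)"
    by (intro sum_mono) (simp add: f_def)
  finally have sm: "p' * card Y \<le> (\<Sum>y\<in>Y. f y)" .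
  have "card Y * p' ^ k \<le> (\<Sum>y\<in>Y. f y ^ k)"
    by (rule sum_power_ge[OF _ p'(2) sm]) (simp add: f_def)
  also have "\<dots> = (\<Sum>y\<in>H. f y ^ k) + (\<Sum>y\<in>Y - H. f y ^ k)"
    using sum.subset_diff[OF finH(2) fin(2), of "\<lambda>y. f y ^ k"] by simp
  finally have split: "card Y * p' ^ k \<le> (\<Sum>y\<in>H. f y ^ k) + (\<Sum>y\<in>Y - H. f y ^ k)" .
  have "(\<Sum>y\<in>Y - H. f y ^ k) \<le> (\<Sum>y\<in>Y - H. ((1 - \<delta>) * p') ^ k)"
  proof (intro sum_mono power_mono)
    fix y assume "y \<in> Y - H"
    then have "real (d y) - k \<le> (1 - \<delta>) * p' * N" by (auto simp: H_def)
    then show "f y \<le> (1 - \<delta>) * p'"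
      using N p' \<delta> by (simp add: f_def pos_divide_le_eq)
  qed (simp add: f_def)
  also have "\<dots> \<le> card Y * ((1 - \<delta>) * p') ^ k"
    using fin p' \<delta> by (simp add: mult_right_mono card_mono)
  finally have "card Y * p' ^ k - card Y * ((1 - \<delta>) ^ k * p' ^ k) \<le> (\<Sum>y\<in>H. f y ^ k)"
    using split unfolding power_mult_distrib by linarith
  then have main: "p' ^ k * (1 - (1 - \<delta>) ^ k) * card Y \<le> (\<Sum>y\<in>H. f y ^ k)"
    by argo
  have ch: "(N ^ k) * f y ^ k \<le> fact k * real (d y choose k)" if "y \<in> H" for y
  proof -
    have "0 \<le> (1 - \<delta>) * p' * N" using \<delta> p' N by simp
    then have "real k \<le> d y" using that by (auto simp: H_def)
    then have "N ^ k * f y ^ k = (real (d y) - k) ^ k"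
      using N by (simp add: f_def power_divide)
    then show ?thesis using fact_binomial_ge[of k "d y"] \<open>real k \<le> d y\<close> by simp
  qed
  \<comment> \<open>Averaging over all \<open>k\<close>-subsets: if each \<open>S\<close> had too
    few common neighbours, the double count would contradict \<open>main\<close>, because
    \<open>fact k * (card X choose k) \<le> N ^ k\<close>.\<close>
  have "\<exists>S\<in>?P. p' ^ k * (1 - (1 - \<delta>) ^ k) * card Y \<le> card {y\<in>H. \<forall>x\<in>S. E x y}"
  proof (rule ccontr)
    assume "\<not> ?thesis"
    then have less: "card {y\<in>H. \<forall>x\<in>S. E x y} < p' ^ k * (1 - (1 - \<delta>) ^ k) * card Y" if "S \<in> ?P" for S
      using that by force
    have P: "finite ?P" "card ?P = card X choose k" using fin n_subsets[OF fin(1)] by auto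
    have ne: "?P \<noteq> {}" using P k by (metis card.empty binomial_eq_0_iff not_le)
    have "N ^ k * (p' ^ k * (1 - (1 - \<delta>) ^ k) * card Y) \<le> (\<Sum>y\<in>H. N ^ k * f y ^ k)"
      using main N by (simp flip: sum_distrib_left)
    also have "\<dots> \<le> (\<Sum>y\<in>H. fact k * real (d y choose k))"
      using ch by (intro sum_mono) simp
    also have "\<dots> = fact k * real (\<Sum>S\<in>?P. card {y\<in>H. \<forall>x\<in>S. E x y})"
      using sum_card_common_neighbours[OF fin(1) finH(1), where k = k and E = E]
      by (simp add: d_def sum_distrib_left)
    also have "\<dots> < fact k * (\<Sum>S\<in>?P. p' ^ k * (1 - (1 - \<delta>) ^ k) * card Y)"
      unfolding of_nat_sum using less P ne
      by (intro mult_strict_left_mono sum_strict_mono) auto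
    also have "\<dots> = fact k * real (card X choose k) * (p' ^ k * (1 - (1 - \<delta>) ^ k) * card Y)"
      using P by simp
    also have "\<dots> \<le> N ^ k * (p' ^ k * (1 - (1 - \<delta>) ^ k) * card Y)"
      using fact_binomial_le[of k "card X"] p' \<delta>
      by (intro mult_right_mono) (auto simp: N_def power_le_one)
    finally show False by simp
  qed
  then obtain S where "S \<in> ?P" "p' ^ k * (1 - (1 - \<delta>) ^ k) * card Y \<le> card {y\<in>H. \<forall>x\<in>S. E x y}"
    by blast
  then show thesis
    by (intro that[of S "{y\<in>H. \<forall>x\<in>S. E x y}"]) (auto simp: H_def d_def N_def)
qed

lemma power_one_minus_ge:
  fixes x :: real
  assumes "x \<le> 1"
  shows "1 - real k * x \<le> (1 - x) ^ k"
  using Bernoulli_inequality[of "- x" k] assms by simp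

text \<open>Removing \<open>k\<close> vertices lowers the density by at most
  \<open>\<epsilon> * p\<close>, so \<open>p'\<close> can be traded for \<open>p\<close> with
  explicit losses. The parameter \<open>\<delta>\<close> should be small to keep the density,
  whereas \<open>k * \<delta>\<close> should not be small, to keep \<open>Y'\<close> large.\<close>

lemma sampling_step:
  fixes p \<delta> \<epsilon> :: real
  assumes fin: "finite X" "finite Y" and p: "0 < p" "p \<le> 1" and X: "card X > 0"
    and dens: "p * card X * card Y \<le> edge_count E X Y"
    and k: "k \<le> \<epsilon> * p * card X" and \<epsilon>: "0 \<le> \<epsilon>" "\<epsilon> \<le> \<delta>" "\<delta> \<le> 1"
  obtains S Y' where "S \<subseteq> X" "card S = k" "Y' \<subseteq> Y"
    "\<And>x y. x \<in> S \<Longrightarrow> y \<in> Y' \<Longrightarrow> E x y"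
    "(1 - 2 * \<delta>) * p * card (X - S) * card Y' \<le> edge_count E (X - S) Y'"
    "(1 - \<epsilon>) * card X \<le> card (X - S)"
    "p ^ k * (1 - k * \<epsilon>) * (1 - 1 / (1 + k * \<delta>)) * card Y \<le> card Y'"
proof -
  define p' where "p' = p - k / card X"
  have kX: "real k \<le> \<epsilon> * card X"
  proof -
    have "\<epsilon> * p * card X \<le> \<epsilon> * 1 * card X"
      using p \<epsilon> by (intro mult_mono) auto
    then show ?thesis using k by simp
  qed
  also have "\<dots> \<le> 1 * real (card X)" using \<epsilon> by (intro mult_right_mono) auto
  finally have kX': "k \<le> card X" by simp
  have "k / card X \<le> \<epsilon> * p" using k X by (simp add: pos_divide_le_eq)
  then have p'_ge: "(1 - \<epsilon>) * p \<le> p'" by (simp add: p'_def algebra_simps)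
  moreover have "0 \<le> (1 - \<epsilon>) * p" using \<epsilon> p by simp
  ultimately have p'0: "0 \<le> p'" by linarith
  have \<delta>: "0 \<le> \<delta>" using \<epsilon> by simp
  obtain S Y' where S: "S \<subseteq> X" "card S = k" "Y' \<subseteq> Y"
    "\<And>x y. x \<in> S \<Longrightarrow> y \<in> Y' \<Longrightarrow> E x y"
    "\<And>y. y \<in> Y' \<Longrightarrow> k + (1 - \<delta>) * p' * card X \<le> card {x\<in>X. E x y}"
    "p' ^ k * (1 - (1 - \<delta>) ^ k) * card Y \<le> card Y'"
    by (rule common_neighbourhood_sampling[OF fin kX' X dens p'_def p'0 \<delta> \<epsilon>(3)])
      (rule that; assumption)
  have finS: "finite S" using S fin finite_subset by blast
  have cXS: "real (card (X - S)) = card X - k"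
    using S finS kX' by (simp add: card_Diff_subset)
  have "(1 - 2 * \<delta>) * p * card (X - S) * card Y' = (\<Sum>y\<in>Y'. (1 - 2 * \<delta>) * p * card (X - S))"
    by simp
  also have "\<dots> \<le> (\<Sum>y\<in>Y'. real (card {x\<in>X - S. E x y}))"
  proof (rule sum_mono)
    fix y assume y: "y \<in> Y'"
    have "{x\<in>X - S. E x y} = {x\<in>X. E x y} - S" by auto
    moreover have "S \<subseteq> {x\<in>X. E x y}" using S y by auto
    ultimately have "real (card {x\<in>X - S. E x y}) = real (card {x\<in>X. E x y}) - k"
      using S finS card_mono[of "{x\<in>X. E x y}" S] fin
      by (simp add: card_Diff_subset of_nat_diff)
    then have 1: "(1 - \<delta>) * p' * card X \<le> card {x\<in>X - S. E x y}" using S(5)[OF y] by linarith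
    have "(1 - 2 * \<delta>) \<le> (1 - \<delta>) * (1 - \<epsilon>)"
    proof -
      have "0 \<le> \<delta> * \<epsilon>" using \<delta> \<epsilon> by simp
      moreover have "(1 - \<delta>) * (1 - \<epsilon>) = 1 - \<delta> - \<epsilon> + \<delta> * \<epsilon>" by (simp add: algebra_simps)
      ultimately show ?thesis using \<epsilon> by linarith
    qed
    then have "(1 - 2 * \<delta>) * p * card (X - S) \<le> (1 - \<delta>) * (1 - \<epsilon>) * p * card (X - S)"
      using p by (intro mult_right_mono) auto
    also have "\<dots> = (1 - \<delta>) * ((1 - \<epsilon>) * p) * card (X - S)" by simp
    also have "\<dots> \<le> (1 - \<delta>) * p' * card X"
      using p'_ge \<epsilon> p'0 fin by (intro mult_mono mult_left_mono) (auto intro: card_mono)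
    finally show "(1 - 2 * \<delta>) * p * card (X - S) \<le> card {x\<in>X - S. E x y}" using 1 by linarith
  qed
  also have "\<dots> = edge_count E (X - S) Y'"
    using fin by (subst edge_count_eq_sum_card) auto
  finally have d: "(1 - 2 * \<delta>) * p * card (X - S) * card Y' \<le> edge_count E (X - S) Y'" .
  have a1: "p ^ k * (1 - k * \<epsilon>) \<le> p' ^ k"
  proof -
    have "p ^ k * (1 - k * \<epsilon>) \<le> p ^ k * (1 - \<epsilon>) ^ k"
      using power_one_minus_ge[of \<epsilon> k] \<epsilon> p by (intro mult_left_mono) auto
    also have "\<dots> = ((1 - \<epsilon>) * p) ^ k" by (simp add: power_mult_distrib)
    also have "\<dots> \<le> p' ^ k" using p'_ge \<epsilon> p by (intro power_mono) auto
    finally show ?thesis .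
  qed
  \<comment> \<open>Bernoulli bounds \<open>1 + k * \<delta>\<close> by
    \<open>(1 + \<delta>) ^ k\<close>, and
    \<open>(1 - \<delta>) * (1 + \<delta>) \<le> 1\<close>.\<close>
  have a2: "1 - 1 / (1 + k * \<delta>) \<le> 1 - (1 - \<delta>) ^ k"
  proof -
    have "(1 - \<delta>) ^ k * (1 + k * \<delta>) \<le> (1 - \<delta>) ^ k * (1 + \<delta>) ^ k"
      using Bernoulli_inequality[of \<delta> k] \<delta> \<epsilon> by (intro mult_left_mono) auto
    also have "\<dots> = (1 - \<delta> * \<delta>) ^ k" by (simp add: algebra_simps flip: power_mult_distrib)
    also have "\<dots> \<le> 1" using \<delta> \<epsilon> by (intro power_le_one) (auto simp: mult_le_one)
    finally have "(1 - \<delta>) ^ k \<le> 1 / (1 + k * \<delta>)"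
      using \<delta> by (simp add: pos_le_divide_eq add_pos_nonneg)
    then show ?thesis by simp
  qed
  have "p ^ k * (1 - k * \<epsilon>) * (1 - 1 / (1 + k * \<delta>)) * card Y
      \<le> p' ^ k * (1 - (1 - \<delta>) ^ k) * card Y"
  proof (intro mult_right_mono[OF mult_mono[OF a1 a2]])
    show "0 \<le> 1 - 1 / (1 + k * \<delta>)" using \<delta> by (simp add: divide_le_eq)
  qed (use p'0 in auto)
  with S(6) have "p ^ k * (1 - k * \<epsilon>) * (1 - 1 / (1 + k * \<delta>)) * card Y \<le> card Y'" by linarith
  moreover have "(1 - \<epsilon>) * card X \<le> card (X - S)" using cXS kX by (simp add: algebra_simps)
  ultimately show thesis using that[of S Y'] S d by blast
qed

lemma biclique_exists:
  fixes p \<epsilon> :: real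
  assumes fin: "finite X" "finite Y" and p: "0 < p" "p \<le> 1"
    and dens: "p * card X * card Y \<le> edge_count E X Y"
    and k: "1 \<le> k" "k \<le> \<epsilon> * p * card X" "k * \<epsilon> \<le> 1 / 2" "0 \<le> \<epsilon>"
    and s: "4 * s \<le> card Y * p ^ k"
  obtains A B where "A \<subseteq> X" "card A = k" "B \<subseteq> Y" "card B = s"
    "\<And>x y. x \<in> A \<Longrightarrow> y \<in> B \<Longrightarrow> E x y"
proof -
  have "\<epsilon> \<le> k * \<epsilon>" using k by (simp add: mult_le_cancel_right1)
  then have \<epsilon>: "\<epsilon> \<le> 1" using k by linarith
  have X: "card X > 0" using k by (cases "card X") auto
  obtain S Y' where S: "S \<subseteq> X" "card S = k" "Y' \<subseteq> Y"
    "\<And>x y. x \<in> S \<Longrightarrow> y \<in> Y' \<Longrightarrow> E x y"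
    "p ^ k * (1 - k * \<epsilon>) * (1 - 1 / (1 + real k * 1)) * card Y \<le> card Y'"
    by (rule sampling_step[OF fin p X dens k(2,4) \<epsilon> order_refl])
      (rule that; assumption)
  have "s \<le> p ^ k * (1 / 2) * (1 / 2) * card Y" using s by (simp add: mult.commute)
  also have "\<dots> \<le> p ^ k * (1 - k * \<epsilon>) * (1 - 1 / (1 + real k * 1)) * card Y"
    using k p by (intro mult_right_mono mult_mono) (auto simp: field_simps)
  finally have "s \<le> card Y'" using S(5) by linarith
  then obtain B where "B \<subseteq> Y'" "card B = s" using obtain_subset_with_card_n by metis
  then show thesis using that[of S B] S by blast
qed

section \<open>Unbalanced bicliques by iterated sampling\<close>

text \<open>Each rung is the square of the previous one. From a side of order
  \<open>p ^ (-y^2)\<close>, the removal of at most \<open>y ^ 4\<close> vertices is then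
  negligible, while \<open>1 / y\<close> still decreases at least geometrically along the
  ladder.\<close>

definition ladder :: "nat \<Rightarrow> nat" where "ladder i = 32 ^ (2 ^ i)"

lemma ladder_0 [simp]: "ladder 0 = 32"
  by (simp add: ladder_def)

lemma ladder_Suc: "ladder (Suc i) = ladder i ^ 2"
  by (simp add: ladder_def mult.commute flip: power_mult)

lemma ladder_ge: "32 * 2 ^ i \<le> ladder i"
proof (induction i)
  case (Suc i)
  have "32 * 2 ^ Suc i = (32 * 2 ^ i) * (2::nat)" by simp
  also have "\<dots> \<le> ladder i * ladder i"
  proof (rule mult_le_mono[OF Suc])
    have "(1::nat) \<le> 2 ^ i" by simp
    then show "2 \<le> ladder i" using Suc by linarith
  qed
  finally show ?case by (simp add: ladder_Suc power2_eq_square)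
qed simp

lemma ladder_ge_32: "32 \<le> ladder i"
proof -
  have "(1::nat) \<le> 2 ^ i" by simp
  then show ?thesis using ladder_ge[of i] by linarith
qed

text \<open>As \<open>p \<le> 1 / 2\<close>, a side of order \<open>p ^ (-n)\<close> has degrees
  \<open>p * N\<close> exponential in \<open>n\<close>. This makes samples of polynomial size
  negligible.\<close>

lemma power_mult_ge:
  fixes p M N :: real
  assumes "0 < p" "p \<le> 1 / 2" "0 < n" "M \<le> N * p ^ n" "0 \<le> M"
  shows "M * 2 ^ (n - 1) \<le> p * N"
proof -
  have "M * 2 ^ (n - 1) \<le> N * p ^ n * 2 ^ (n - 1)" using assms by (intro mult_right_mono) auto
  also have "\<dots> = (p * N) * (2 * p) ^ (n - 1)"
    using assms(3) by (cases n) (auto simp: power_mult_distrib)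
  also have "\<dots> \<le> (p * N) * 1"
  proof -
    have "0 \<le> N * p ^ n" using assms by linarith
    moreover have "0 < p ^ n" using assms by simp
    ultimately have "0 \<le> N" by (simp add: zero_le_mult_iff)
    then show ?thesis using assms by (intro mult_left_mono power_le_one) auto
  qed
  finally show ?thesis by simp
qed

text \<open>In \<open>biclique_ladder\<close> the exponent 9 is \<open>4 + 5\<close>: about
  \<open>y ^ 4\<close> vertices are sampled with relative loss \<open>1 / y ^ 5\<close>.\<close>

lemma two_power_ge:
  assumes "8 \<le> (y::nat)"
  shows "y ^ 9 \<le> 2 ^ (y\<^sup>2 - 1)"
proof -
  have "y \<le> 2 ^ (y - 1)" using less_exp[of "y - 1"] assms by linarith
  then have "y ^ 9 \<le> (2 ^ (y - 1)) ^ 9" by (rule power_mono) simp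
  also have "\<dots> = 2 ^ ((y - 1) * 9)" by (simp add: power_mult)
  also have "\<dots> \<le> 2 ^ (y\<^sup>2 - 1)"
  proof (rule power_increasing)
    have "(y - 1) * 9 \<le> (y - 1) * (y + 1)" using assms by (intro mult_le_mono) auto
    also have "\<dots> = y\<^sup>2 - 1" by (simp add: algebra_simps power2_eq_square)
    finally show "(y - 1) * 9 \<le> y\<^sup>2 - 1" .
  qed simp
  finally show ?thesis .
qed

lemma one_minus_product_ge:
  fixes a b :: real
  assumes "0 \<le> a" "a \<le> 1" "0 \<le> b" "b \<le> 1"
  shows "1 - (a + b) \<le> (1 - a) * (1 - b)"
proof -
  have "0 \<le> a * b" using assms by simp
  then show ?thesis by (simp add: algebra_simps)
qed

text \<open>With \<open>y = ladder i\<close>, choosing \<open>y ^ 4 - y\<close> vertices of \<open>X\<close> reduces the case \<open>Suc i\<close> to the case \<open>i\<close>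
  with the sides exchanged. The relative loss is \<open>O(1 / y)\<close>, which is summable along the ladder.\<close>

lemma biclique_ladder:
  fixes p :: real and X Y :: "'a set"
  assumes "finite X" "finite Y" "0 < p" "p \<le> 1 / 2"
    and "p * card X * card Y \<le> edge_count E X Y"
    and "2 ^ 21 * (2 - (1 / 2) ^ i) \<le> card X * p ^ ladder i"
    and "2 ^ 21 * (2 - (1 / 2) ^ i) \<le> card Y * p ^ ladder (Suc i)"
  shows "\<exists>A B. A \<subseteq> X \<and> card A = ladder (Suc i) \<and> B \<subseteq> Y \<and> card B = ladder i \<and>
    (\<forall>x\<in>A. \<forall>y\<in>B. E x y)"
  using assms
proof (induction i arbitrary: X Y E p)
  case 0
  have "2 ^ 21 * 2 ^ (32 - 1) \<le> p * card X"
    using 0 by (intro power_mult_ge) auto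
  \<comment> \<open>The bottom rungs 32 and 1024 are reached by a single averaging, with
    \<open>\<epsilon> = 1 / 2048\<close> so that \<open>1024 * \<epsilon> = 1 / 2\<close>.\<close>
  then have "real 1024 \<le> 1 / 2048 * p * card X" by simp
  moreover have "real (4 * 32) \<le> card Y * p ^ 1024" using 0 by (simp add: ladder_Suc)
  ultimately obtain A B where "A \<subseteq> X" "card A = 1024" "B \<subseteq> Y" "card B = 32"
    "\<And>x y. x \<in> A \<Longrightarrow> y \<in> B \<Longrightarrow> E x y"
    using 0 by (elim biclique_exists[of X Y p E 1024 "1 / 2048" 32, rotated -1]) auto
  then show ?case by (intro exI[of _ A] exI[of _ B]) (simp add: ladder_Suc)
next
  case (Suc i)
  define K :: real where "K = 2 ^ 21 * (2 - (1 / 2) ^ Suc i)"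
  define y where "y = ladder i"
  define k where "k = y ^ 4 - y"
  \<comment> \<open>The powers are balanced so that every loss is \<open>O(1 / y)\<close>:
    \<open>k * \<epsilon> \<le> 1 / y\<close>, \<open>1 + k * \<delta> \<ge> y\<close>, and
    \<open>(1 - 2 * \<delta>) ^ n \<ge> 1 - 2 / y\<close> for all \<open>n\<close> up to
    \<open>y^2\<close>.\<close>
  define \<epsilon> :: real where "\<epsilon> = 1 / y ^ 5"
  define \<delta> :: real where "\<delta> = 1 / y ^ 3"
  define p2 where "p2 = (1 - 2 * \<delta>) * p"
  have fin: "finite X" "finite Y" and p: "0 < p" "p \<le> 1 / 2"
    and dens: "p * card X * card Y \<le> edge_count E X Y" using Suc.prems by auto
  have X: "K \<le> card X * p ^ (y\<^sup>2)" and Y: "K \<le> card Y * p ^ (y ^ 4)"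
    using Suc.prems by (simp_all add: K_def y_def ladder_Suc flip: power_mult)
  have y: "32 \<le> y" "32 * 2 ^ i \<le> y" using ladder_ge ladder_ge_32 by (auto simp: y_def)
  have ry: "32 \<le> real y" and [simp]: "0 < y" using y by simp_all
  have inv_y: "0 < 1 / real y" "1 / real y \<le> 1 / 32"
    using ry by (auto intro!: divide_left_mono)
  have "(1 / 2) ^ Suc i \<le> (1::real)" by (rule power_le_one) auto
  then have K: "2 ^ 21 \<le> K" by (simp add: K_def)
  have yk: "y ^ 1 \<le> y ^ 4" using y by (intro power_increasing) auto
  have \<delta>\<epsilon>: "0 \<le> \<epsilon>" "\<epsilon> \<le> \<delta>" "\<delta> \<le> 1 / 32" "\<delta> > 0"
  proof -
    have "real y ^ 1 \<le> real y ^ 3" using ry by (intro power_increasing) auto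
    then have "32 \<le> real y ^ 3" using ry by (simp only: power_one_right)
    then show "\<delta> \<le> 1 / 32" unfolding \<delta>_def by (intro divide_left_mono) auto
    show "\<epsilon> \<le> \<delta>" unfolding \<delta>_def \<epsilon>_def using ry
      by (intro divide_left_mono power_increasing) auto
  qed (use ry in \<open>auto simp: \<epsilon>_def \<delta>_def\<close>)
  have "1 * 2 ^ (y\<^sup>2 - 1) \<le> K * 2 ^ (y\<^sup>2 - 1)" using K by (intro mult_right_mono) auto
  also have "\<dots> \<le> p * card X" using p y X K by (intro power_mult_ge) auto
  finally have "2 ^ (y\<^sup>2 - 1) \<le> p * card X" by simp
  moreover have "real (y ^ 9) \<le> real (2 ^ (y\<^sup>2 - 1))"
    using two_power_ge[of y] y by (subst of_nat_le_iff) auto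
  ultimately have pX: "real y ^ 9 \<le> p * card X" by simp
  have kX: "k \<le> \<epsilon> * p * card X"
  proof -
    have "real k \<le> real (y ^ 4)" by (subst of_nat_le_iff) (simp add: k_def)
    also have "\<dots> = \<epsilon> * real y ^ 9" using ry by (simp add: \<epsilon>_def field_simps flip: power_add)
    also have "\<dots> \<le> \<epsilon> * (p * card X)" using pX \<delta>\<epsilon> by (intro mult_left_mono) auto
    finally show ?thesis by (simp add: mult.assoc)
  qed
  have "card X > 0"
  proof (rule ccontr)
    assume "\<not> card X > 0"
    then show False using X K by simp
  qed
  then obtain S Y' where S: "S \<subseteq> X" "card S = k" "Y' \<subseteq> Y"
    "\<And>x y. x \<in> S \<Longrightarrow> y \<in> Y' \<Longrightarrow> E x y"
    "p2 * card (X - S) * card Y' \<le> edge_count E (X - S) Y'"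
    "(1 - \<epsilon>) * card X \<le> card (X - S)"
    "p ^ k * (1 - k * \<epsilon>) * (1 - 1 / (1 + k * \<delta>)) * card Y \<le> card Y'"
    using \<delta>\<epsilon> p unfolding p2_def
    by (elim sampling_step[OF fin _ _ _ dens kX \<delta>\<epsilon>(1,2), rotated -1]) auto
  have "1 - 1 / y \<le> 1 - k * \<epsilon>"
  proof -
    have "real k \<le> real (y ^ 4)" by (subst of_nat_le_iff) (simp add: k_def)
    then have "k * \<epsilon> \<le> y ^ 4 * \<epsilon>" using \<delta>\<epsilon> by (intro mult_right_mono) auto
    also have "\<dots> = 1 / y" using ry by (simp add: \<epsilon>_def field_simps eval_nat_numeral)
    finally show ?thesis by simp
  qed
  moreover have "1 - 1 / y \<le> 1 - 1 / (1 + k * \<delta>)"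
  proof -
    have "real k = real y ^ 4 - real y" using yk by (simp add: k_def of_nat_diff)
    then have "k * \<delta> = real y - 1 / real y ^ 2"
      using ry by (simp add: \<delta>_def field_simps eval_nat_numeral)
    moreover have "1 / real y ^ 2 \<le> 1" using ry by (simp add: divide_le_eq)
    ultimately have "y \<le> 1 + k * \<delta>" by linarith
    then have "1 / (1 + k * \<delta>) \<le> 1 / y" using ry by (intro divide_left_mono) auto
    then show ?thesis by simp
  qed
  ultimately have "(1 - 1 / y) * (1 - 1 / y) \<le> (1 - k * \<epsilon>) * (1 - 1 / (1 + k * \<delta>))"
    using inv_y by (intro mult_mono) linarith+
  then have "p ^ k * card Y * ((1 - 1 / y) * (1 - 1 / y))
      \<le> p ^ k * card Y * ((1 - k * \<epsilon>) * (1 - 1 / (1 + k * \<delta>)))"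
    using p by (intro mult_left_mono) auto
  also have "\<dots> \<le> card Y'" using S(7) by (simp add: mult_ac)
  finally have Y': "p ^ k * card Y * ((1 - 1 / y) * (1 - 1 / y)) \<le> card Y'" .
  \<comment> \<open>From \<open>i\<close> to \<open>Suc i\<close> the budget
    \<open>2 - (1 / 2) ^ i\<close> grows by \<open>h = (1 / 2) ^ Suc i\<close>. The step loses the
    share \<open>4 / y\<close> of a budget below 2, hence at most \<open>8 / y\<close>, and this is
    at most \<open>h\<close> because \<open>y \<ge> 32 * 2 ^ i\<close>.\<close>
  have K': "2 ^ 21 * (2 - (1 / 2) ^ i) \<le> K * (1 - 4 / y)"
  proof -
    have "8 / real y \<le> 8 / (32 * 2 ^ i)"
    proof (intro divide_left_mono)
      have "real (32 * 2 ^ i) \<le> real y" using y(2) by (subst of_nat_le_iff)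
      then show "32 * 2 ^ i \<le> real y" by simp
    qed (use ry in auto)
    also have "\<dots> \<le> (1 / 2) ^ Suc i" by (simp add: power_divide field_simps)
    finally have "8 / real y \<le> (1 / 2) ^ Suc i" .
    moreover define h :: real where "h = (1 / 2) ^ Suc i"
    ultimately have h: "8 / real y \<le> h" "(1 / 2) ^ i = 2 * h" "0 \<le> h" by (auto simp: h_def)
    have "(2 - h) * (4 / real y) \<le> 2 * (4 / real y)"
      using h by (intro mult_right_mono) auto
    then have "2 - (1 / 2) ^ i \<le> (2 - h) * (1 - 4 / real y)"
      using h by (simp add: right_diff_distrib)
    then have "2 ^ 21 * (2 - (1 / 2) ^ i) \<le> 2 ^ 21 * ((2 - h) * (1 - 4 / real y))"
      by (rule mult_left_mono) simp
    then show ?thesis by (simp only: K_def h_def mult.assoc)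
  qed
  have p2: "0 < p2" "p2 \<le> 1 / 2"
  proof -
    show "0 < p2" using \<delta>\<epsilon> p by (simp add: p2_def)
    have "p2 \<le> 1 * p" unfolding p2_def using \<delta>\<epsilon> p by (intro mult_right_mono) auto
    then show "p2 \<le> 1 / 2" using p by simp
  qed
  have p2_pow: "p ^ n * (1 - 2 / y) \<le> p2 ^ n" if "n \<le> y\<^sup>2" for n
  proof -
    have "1 - 2 / y = 1 - real (y\<^sup>2) * (2 * \<delta>)"
      using ry by (simp add: \<delta>_def field_simps eval_nat_numeral)
    also have "\<dots> \<le> 1 - n * (2 * \<delta>)"
      using \<delta>\<epsilon> that by (simp del: of_nat_power)
    also have "\<dots> \<le> (1 - 2 * \<delta>) ^ n" using \<delta>\<epsilon> by (intro power_one_minus_ge) auto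
    finally have "p ^ n * (1 - 2 / y) \<le> p ^ n * (1 - 2 * \<delta>) ^ n"
      using p by (intro mult_left_mono) auto
    then show ?thesis by (simp add: p2_def power_mult_distrib mult.commute)
  qed
  have sq: "1 - 4 / y \<le> (1 - 1 / real y) * (1 - 1 / y) * (1 - 2 / y)"
  proof -
    have "1 - 2 / real y \<le> (1 - 1 / real y) * (1 - 1 / y)"
      using one_minus_product_ge[of "1 / real y" "1 / real y"] inv_y by simp
    then have "(1 - 2 / real y) * (1 - 2 / y) \<le> (1 - 1 / real y) * (1 - 1 / y) * (1 - 2 / y)"
      using ry by (intro mult_right_mono) (auto simp: divide_le_eq)
    moreover have "1 - (2 / real y + 2 / real y) \<le> (1 - 2 / real y) * (1 - 2 / y)"
      using ry by (intro one_minus_product_ge) (auto simp: divide_le_eq)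
    ultimately show ?thesis by simp
  qed
  have Y'K: "2 ^ 21 * (2 - (1 / 2) ^ i) \<le> card Y' * p2 ^ ladder i"
  proof -
    have "K * (1 - 4 / y) \<le> (card Y * p ^ (y ^ 4)) * ((1 - 1 / real y) * (1 - 1 / y) * (1 - 2 / y))"
      using K inv_y Y sq by (intro mult_mono) (auto simp: divide_le_eq)
    \<comment> \<open>Sampling spends \<open>p ^ k\<close> and leaves the exponent \<open>y\<close>
      of the lower rung; this dictates \<open>k = y ^ 4 - y\<close>.\<close>
    also have "p ^ (y ^ 4) = p ^ k * p ^ y" using yk by (simp add: k_def flip: power_add)
    also have "(card Y * (p ^ k * p ^ y)) * ((1 - 1 / real y) * (1 - 1 / y) * (1 - 2 / y))
        = (p ^ k * card Y * ((1 - 1 / y) * (1 - 1 / y))) * (p ^ y * (1 - 2 / y))"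
      by (simp add: mult_ac)
    also have "\<dots> \<le> card Y' * p2 ^ y"
    proof (rule mult_mono[OF Y'])
      have "y ^ 1 \<le> y\<^sup>2" using y by (intro power_increasing) auto
      then show "p ^ y * (1 - 2 / y) \<le> p2 ^ y" by (intro p2_pow) simp
      show "0 \<le> p ^ y * (1 - 2 / y)" using p ry by (auto simp: divide_le_eq)
    qed simp
    finally show ?thesis using K' by (simp add: y_def)
  qed
  have XK: "2 ^ 21 * (2 - (1 / 2) ^ i) \<le> card (X - S) * p2 ^ ladder (Suc i)"
  proof -
    have "\<epsilon> \<le> 1 / real y" unfolding \<epsilon>_def using ry
      by (intro divide_left_mono) (auto intro!: self_le_power)
    have "1 - 4 / real y \<le> (1 - 1 / y) * (1 - 2 / y)"
    proof -
      have "1 - (1 / real y + 2 / real y) \<le> (1 - 1 / y) * (1 - 2 / y)"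
        using ry by (intro one_minus_product_ge) (auto simp: divide_le_eq)
      moreover have "3 / real y \<le> 4 / real y" by (intro divide_right_mono) auto
      ultimately show ?thesis by simp
    qed
    also have "\<dots> \<le> (1 - \<epsilon>) * (1 - 2 / y)"
      using \<open>\<epsilon> \<le> 1 / real y\<close> ry by (intro mult_right_mono) (auto simp: divide_le_eq)
    finally have "K * (1 - 4 / y) \<le> (card X * p ^ (y\<^sup>2)) * ((1 - \<epsilon>) * (1 - 2 / y))"
      using K inv_y X by (intro mult_mono) (auto simp: divide_le_eq)
    also have "\<dots> = ((1 - \<epsilon>) * card X) * (p ^ (y\<^sup>2) * (1 - 2 / y))" by (simp add: mult_ac)
    also have "\<dots> \<le> card (X - S) * p2 ^ (y\<^sup>2)"
      using p ry by (intro mult_mono[OF S(6)] p2_pow) (auto simp: divide_le_eq)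
    finally show ?thesis using K' by (simp add: y_def ladder_Suc)
  qed
  have "finite Y'" "finite (X - S)" using fin S finite_subset by auto
  moreover have "p2 * card Y' * card (X - S) \<le> edge_count (\<lambda>y x. E x y) Y' (X - S)"
    using S(5) by (subst edge_count_swap) (simp add: mult_ac)
  ultimately have "\<exists>A B. A \<subseteq> Y' \<and> card A = ladder (Suc i) \<and> B \<subseteq> X - S \<and> card B = ladder i \<and>
      (\<forall>x\<in>A. \<forall>y\<in>B. E y x)"
    using p2 Y'K XK by (intro Suc.IH[where p = p2]) auto
  then obtain A B where AB: "A \<subseteq> Y'" "card A = ladder (Suc i)" "B \<subseteq> X - S" "card B = ladder i"
    "\<forall>x\<in>A. \<forall>y\<in>B. E y x"
    by blast
  have "card (S \<union> B) = k + y"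
    using S AB finite_subset[OF S(1) fin(1)] finite_subset[OF AB(3)] fin
    by (subst card_Un_disjoint) (auto simp: y_def)
  also have "\<dots> = ladder (Suc (Suc i))"
    using yk by (simp add: k_def y_def ladder_Suc)
  finally show ?case
    using S AB by (intro exI[of _ "S \<union> B"] exI[of _ A]) auto
qed

section \<open>Balanced bicliques without a growing factor\<close>

text \<open>By Bernoulli, the density loss incurred in \<open>sampling_half\<close> costs only a
  constant factor in every size condition with exponent up to \<open>t\<close>.\<close>

lemma damped_power_ge:
  fixes p :: real
  assumes "0 < p" "1 \<le> t" "n \<le> t"
  shows "p ^ n / 2 \<le> ((1 - 1 / (2 * real t)) * p) ^ n"
proof -
  have "1 / 2 \<le> 1 - real n * (1 / (2 * real t))" using assms by (simp add: field_simps)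
  also have "\<dots> \<le> (1 - 1 / (2 * real t)) ^ n"
    using assms by (intro power_one_minus_ge) (auto simp: field_simps)
  finally have "p ^ n * (1 / 2) \<le> p ^ n * (1 - 1 / (2 * real t)) ^ n"
    using assms by (intro mult_left_mono) auto
  then show ?thesis by (simp add: power_mult_distrib mult.commute)
qed

text \<open>This is \<open>sampling_step\<close> with
  \<open>\<epsilon> = \<delta> = 1 / (4 t)\<close>. Since \<open>t / 2 \<le> t - s \<le> t\<close>,
  the product \<open>k * \<delta>\<close> lies between \<open>1 / 8\<close> and
  \<open>1 / 4\<close>; the loss factors are at least \<open>3 / 4\<close> and \<open>1 / 9\<close>,
  whence 12.\<close>

lemma sampling_half:
  fixes p :: real
  assumes fin: "finite X" "finite Y" and p: "0 < p" "p \<le> 1"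
    and dens: "p * card X * card Y \<le> edge_count E X Y"
    and t: "1 \<le> t" "2 * s \<le> t" "4 * real t ^ 2 \<le> p * card X"
  obtains S Y' where "S \<subseteq> X" "card S = t - s" "Y' \<subseteq> Y"
    "\<And>x y. x \<in> S \<Longrightarrow> y \<in> Y' \<Longrightarrow> E x y"
    "(1 - 1 / (2 * real t)) * p * card (X - S) * card Y' \<le> edge_count E (X - S) Y'"
    "card X \<le> 2 * card (X - S)" "p ^ (t - s) * card Y \<le> 12 * card Y'"
proof -
  define k where "k = t - s"
  define \<delta> where "\<delta> = 1 / (4 * real t)"
  have \<delta>: "0 \<le> \<delta>" "\<delta> \<le> 1 / 4" using t by (auto simp: \<delta>_def field_simps)
  have k: "real k \<le> t" "t \<le> 2 * real k" using t by (auto simp: k_def)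
  have "t * (4 * real t) \<le> p * card X" using t(3) by (simp add: power2_eq_square)
  then have "t \<le> \<delta> * p * card X" using t(1) by (simp add: \<delta>_def field_simps)
  then have kX: "k \<le> \<delta> * p * card X" using k by linarith
  have X: "card X > 0"
  proof (rule ccontr)
    assume "\<not> card X > 0"
    then show False using t by simp
  qed
  obtain S Y' where S: "S \<subseteq> X" "card S = k" "Y' \<subseteq> Y"
    "\<And>x y. x \<in> S \<Longrightarrow> y \<in> Y' \<Longrightarrow> E x y"
    "(1 - 2 * \<delta>) * p * card (X - S) * card Y' \<le> edge_count E (X - S) Y'"
    "(1 - \<delta>) * card X \<le> card (X - S)"
    "p ^ k * (1 - k * \<delta>) * (1 - 1 / (1 + k * \<delta>)) * card Y \<le> card Y'"
    using \<delta> by (elim sampling_step[OF fin p X dens kX \<delta>(1) order_refl, rotated -1]) auto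
  have k\<delta>: "1 / 8 \<le> k * \<delta>" "k * \<delta> \<le> 1 / 4" using k t by (auto simp: \<delta>_def field_simps)
  have "1 / (1 + k * \<delta>) \<le> 8 / 9" using k\<delta> by (simp add: divide_le_eq)
  then have "p ^ k * card Y * (3 / 4 * (1 / 9)) \<le> p ^ k * card Y * ((1 - k * \<delta>) * (1 - 1 / (1 + k * \<delta>)))"
    using k\<delta> p by (intro mult_left_mono mult_mono) auto
  moreover have "p ^ k * card Y * ((1 - k * \<delta>) * (1 - 1 / (1 + k * \<delta>))) \<le> card Y'"
    using S(7) by (simp add: mult_ac)
  ultimately have "p ^ k * card Y \<le> 12 * card Y'" by linarith
  moreover have "(1 / 2) * real (card X) \<le> (1 - \<delta>) * card X" using \<delta> by (intro mult_right_mono) auto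
  moreover have "1 - 2 * \<delta> = 1 - 1 / (2 * real t)" by (simp add: \<delta>_def)
  ultimately show thesis using S by (intro that[of S Y']) (auto simp: k_def)
qed

text \<open>The threshold 2048 is \<open>2 * ladder 1\<close>, and the ladder is unbounded, so
  \<open>t\<close> is passed between two consecutive rungs.\<close>

lemma ladder_bracket:
  assumes "2048 \<le> t"
  obtains i where "2 * ladder (Suc i) \<le> t" "t < 2 * ladder (Suc (Suc i))"
proof -
  define P where "P i \<longleftrightarrow> t < 2 * ladder (Suc i)" for i
  have "t < 2 * ladder (Suc t)"
    using ladder_ge[of "Suc t"] less_exp[of "Suc t"] by simp
  then have "P t" by (simp add: P_def)
  moreover have "\<not> P 0" using assms by (simp add: P_def ladder_Suc)
  ultimately obtain i where "\<not> P i" "P (Suc i)"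
    using ex_least_nat_less[of P t] by blast
  then show thesis using that[of i] by (simp add: P_def)
qed

text \<open>Averaging once over \<open>t\<close>-sets needs sides of order \<open>t p ^ (-t)\<close>. Choosing only \<open>t - s\<close> vertices
  first shrinks the other side to \<open>p ^ (-s)\<close> at the cost of a constant factor; doing this on both
  sides leads to \<open>biclique_ladder\<close>.\<close>

lemma biclique_sharp:
  fixes p :: real and X Y :: "'a set"
  assumes fin: "finite X" "finite Y" and p: "0 < p" "p \<le> 1 / 2"
    and dens: "p * card X * card Y \<le> edge_count E X Y"
    and t: "1 \<le> t" and X: "2 ^ 30 \<le> card X * p ^ t" and Y: "2 ^ 30 \<le> card Y * p ^ t"
  shows "\<exists>A B. A \<subseteq> X \<and> card A = t \<and> B \<subseteq> Y \<and> card B = t \<and> (\<forall>x\<in>A. \<forall>y\<in>B. E x y)"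
proof -
  have pX: "2 ^ 30 * 2 ^ (t - 1) \<le> p * card X" using p t X by (intro power_mult_ge) auto
  show ?thesis
  proof (cases "t < 2048")
    \<comment> \<open>For bounded \<open>t\<close> the factor \<open>4 * t\<close> lost by a single
      averaging fits into the constant \<open>2 ^ 30\<close>.\<close>
    case True
    then have tr: "real t \<le> 2048" by simp
    have "real t * (2 * real t) \<le> 2048 * (2 * 2048)" using tr by (intro mult_mono) auto
    moreover have "2 ^ 30 \<le> p * card X" using order_trans[OF _ pX, of "2 ^ 30"] by simp
    ultimately have "t * (2 * real t) \<le> p * card X" by simp
    then have "t \<le> 1 / (2 * real t) * p * card X" using t by (simp add: field_simps)
    then obtain A B where "A \<subseteq> X" "card A = t" "B \<subseteq> Y" "card B = t"
      "\<And>x y. x \<in> A \<Longrightarrow> y \<in> B \<Longrightarrow> E x y"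
      using fin p dens t Y tr by (elim biclique_exists[of X Y p E t "1 / (2 * real t)" t, rotated -1]) auto
    then show ?thesis by blast
  next
    case False
    then obtain i where i: "2 * ladder (Suc i) \<le> t" "t < 2 * ladder (Suc (Suc i))"
      using ladder_bracket[of t] by auto
    \<comment> \<open>Once \<open>t - B\<close> vertices of \<open>X\<close> and
      \<open>t - C\<close> of \<open>Y\<close> are chosen, what remains is to find \<open>B\<close>
      vertices in a set of order \<open>p ^ (-C)\<close> and \<open>C\<close> in one of order
      \<open>p ^ (-B)\<close>. This is \<open>biclique_ladder\<close> at \<open>i\<close>.\<close>
    define C where "C = ladder i"
    define B where "B = ladder (Suc i)"
    have BC: "B = C\<^sup>2" "32 \<le> C" "2 * B \<le> t" "t < 2 * B\<^sup>2"
      using i ladder_ge_32 by (auto simp: B_def C_def ladder_Suc)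
    have "C * 1 \<le> C * C" using BC by (intro mult_left_mono) auto
    then have CB: "C \<le> B" using BC by (simp add: power2_eq_square)
    have B32: "32 \<le> B" using CB BC by simp
    \<comment> \<open>The second sampling takes place in \<open>Y1\<close>, which is only guaranteed
      order \<open>p ^ (-B)\<close>. The upper bracket \<open>t < 2 * B^2\<close> keeps
      \<open>4 * t^2\<close> below the resulting degrees.\<close>
    have t9: "4 * real t ^ 2 \<le> 2 ^ (B - 1)"
    proof -
      have "16 * B ^ 4 \<le> C * C ^ 8" using BC by (simp flip: power_mult)
      also have "\<dots> = C ^ 9" by (simp add: eval_nat_numeral)
      also have "\<dots> \<le> 2 ^ (B - 1)" using two_power_ge[of C] BC by simp
      finally have 1: "16 * B ^ 4 \<le> 2 ^ (B - 1)" .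
      have "4 * t\<^sup>2 \<le> 4 * (2 * B\<^sup>2)\<^sup>2" using BC by (intro mult_left_mono power_mono) auto
      also have "\<dots> = 16 * B ^ 4" by (simp add: power_mult_distrib flip: power_mult)
      finally have "4 * t\<^sup>2 \<le> 2 ^ (B - 1)" using 1 by linarith
      then have "real (4 * t\<^sup>2) \<le> real (2 ^ (B - 1))" by (subst of_nat_le_iff)
      then show ?thesis by simp
    qed
    have "4 * real t ^ 2 \<le> 1 * 2 ^ (B - 1)" using t9 by simp
    also have "\<dots> \<le> 2 ^ 30 * 2 ^ (t - 1)"
      using BC by (intro mult_mono power_increasing) auto
    finally have t1: "4 * real t ^ 2 \<le> p * card X" using pX by linarith
    define p1 where "p1 = (1 - 1 / (2 * real t)) * p"
    define p2 where "p2 = (1 - 1 / (2 * real t)) * p1"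
    have h: "0 < 1 - 1 / (2 * real t)" "1 - 1 / (2 * real t) \<le> 1" using t by (auto simp: field_simps)
    have p1: "0 < p1" "p1 \<le> 1 / 2" using h p mult_mono[of "1 - 1 / (2 * real t)" 1 p "1 / 2"]
      by (auto simp: p1_def)
    have p2: "0 < p2" "p2 \<le> 1 / 2" using h p1 mult_mono[of "1 - 1 / (2 * real t)" 1 p1 "1 / 2"]
      by (auto simp: p2_def)
    have p1_pow: "p ^ n \<le> 2 * p1 ^ n" if "n \<le> t" for n
      using damped_power_ge[of p t n] p t that by (simp add: p1_def)
    have p2_pow: "p1 ^ n \<le> 2 * p2 ^ n" if "n \<le> t" for n
      using damped_power_ge[of p1 t n] p1 t that by (simp add: p2_def)
    obtain S1 Y1 where S1: "S1 \<subseteq> X" "card S1 = t - B" "Y1 \<subseteq> Y"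
      "\<And>x y. x \<in> S1 \<Longrightarrow> y \<in> Y1 \<Longrightarrow> E x y"
      "p1 * card (X - S1) * card Y1 \<le> edge_count E (X - S1) Y1"
      "card X \<le> 2 * card (X - S1)" "p ^ (t - B) * card Y \<le> 12 * card Y1"
    proof (rule sampling_half[OF fin p(1) _ dens t _ t1])
      show "p \<le> 1" using p by simp
      show "2 * B \<le> t" using BC by simp
    qed (rule that, assumption+, simp only: p1_def)
    define X1 where "X1 = X - S1"
    have fin1: "finite Y1" "finite X1" using fin S1 finite_subset by (auto simp: X1_def)
    have X1: "2 ^ 30 \<le> 4 * (card X1 * p1 ^ t)"
    proof -
      have "card X * p ^ t \<le> (2 * real (card X1)) * (2 * p1 ^ t)"
        using S1(6) p by (intro mult_mono p1_pow) (auto simp: X1_def)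
      then show ?thesis using X by simp
    qed
    have Y1: "2 ^ 30 \<le> 24 * (card Y1 * p1 ^ B)"
    proof -
      have "card Y * p ^ t = (p ^ (t - B) * card Y) * p ^ B"
        using BC by (simp flip: power_add)
      also have "\<dots> \<le> (12 * card Y1) * (2 * p1 ^ B)"
        using S1(7) p BC by (intro mult_mono p1_pow) auto
      finally show ?thesis using Y by simp
    qed
    have "1 * 2 ^ (B - 1) \<le> (2 ^ 30 / 24) * (2::real) ^ (B - 1)" by (intro mult_right_mono) auto
    also have "\<dots> \<le> p1 * card Y1" using p1 B32 Y1 by (intro power_mult_ge) auto
    finally have t2: "4 * real t ^ 2 \<le> p1 * card Y1" using t9 by linarith
    have dens1: "p1 * card Y1 * card X1 \<le> edge_count (\<lambda>y x. E x y) Y1 X1"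
      using S1(5) by (subst edge_count_swap) (simp add: X1_def mult_ac)
    obtain S2 X2 where S2: "S2 \<subseteq> Y1" "card S2 = t - C" "X2 \<subseteq> X1"
      "\<And>y x. y \<in> S2 \<Longrightarrow> x \<in> X2 \<Longrightarrow> E x y"
      "p2 * card (Y1 - S2) * card X2 \<le> edge_count (\<lambda>y x. E x y) (Y1 - S2) X2"
      "card Y1 \<le> 2 * card (Y1 - S2)" "p1 ^ (t - C) * card X1 \<le> 12 * card X2"
    proof (rule sampling_half[OF fin1 p1(1) _ dens1 t _ t2])
      show "p1 \<le> 1" using p1 by simp
      show "2 * C \<le> t" using BC CB by simp
    qed (rule that, assumption+, simp only: p2_def)
    define Y2 where "Y2 = Y1 - S2"
    \<comment> \<open>The two samplings cost each side at most a factor \<open>96 < 2 ^ 8\<close>,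
      so \<open>2 ^ 22\<close> is left of \<open>2 ^ 30\<close>; this covers the budget of the
      ladder for every \<open>i\<close>.\<close>
    have "2 ^ 21 * (2 - (1 / 2) ^ i) \<le> 2 ^ 21 * (2 - (0::real))"
      by (intro mult_left_mono diff_left_mono) auto
    then have K: "2 ^ 21 * (2 - (1 / 2) ^ i) \<le> (2::real) ^ 22" by simp
    have Y2: "2 ^ 22 \<le> card Y2 * p2 ^ B"
    proof -
      have "card Y1 * p1 ^ B \<le> (2 * real (card Y2)) * (2 * p2 ^ B)"
        using S2(6) p1 BC by (intro mult_mono p2_pow) (auto simp: Y2_def)
      then show ?thesis using Y1 by simp
    qed
    have X2: "2 ^ 22 \<le> card X2 * p2 ^ C"
    proof -
      have "card X1 * p1 ^ t = (p1 ^ (t - C) * card X1) * p1 ^ C"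
        using BC CB by (simp flip: power_add)
      also have "\<dots> \<le> (12 * card X2) * (2 * p2 ^ C)"
        using S2(7) p1 BC CB by (intro mult_mono p2_pow) auto
      finally show ?thesis using X1 by simp
    qed
    have "p2 * card X2 * card Y2 \<le> edge_count E X2 Y2"
      using S2(5) by (subst (asm) edge_count_swap) (simp add: Y2_def mult_ac)
    moreover have "finite X2" "finite Y2" using fin1 S2 finite_subset by (auto simp: Y2_def)
    ultimately have "\<exists>A D. A \<subseteq> X2 \<and> card A = ladder (Suc i) \<and> D \<subseteq> Y2 \<and> card D = ladder i \<and>
        (\<forall>x\<in>A. \<forall>y\<in>D. E x y)"
      using p2 order_trans[OF K X2] order_trans[OF K Y2] unfolding B_def C_def
      by (intro biclique_ladder[where p = p2])
    then obtain A D where AD: "A \<subseteq> X2" "card A = B" "D \<subseteq> Y2" "card D = C"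
      "\<forall>x\<in>A. \<forall>y\<in>D. E x y" by (auto simp: B_def C_def)
    have "card (S1 \<union> A) = (t - B) + B"
      using S1 S2 AD finite_subset[OF S1(1) fin(1)] finite_subset[OF AD(1)] \<open>finite X2\<close>
      by (subst card_Un_disjoint) (auto simp: X1_def)
    moreover have "card (S2 \<union> D) = (t - C) + C"
      using S1 S2 AD finite_subset[OF S2(1) fin1(1)] finite_subset[OF AD(3)] \<open>finite Y2\<close>
      by (subst card_Un_disjoint) (auto simp: Y2_def)
    moreover have "E x y" if "x \<in> S1 \<union> A" "y \<in> S2 \<union> D" for x y
    proof -
      have "y \<in> Y1" using that S2(1) AD(3) by (auto simp: Y2_def)
      then show ?thesis using that S1(4)[of x y] S2(4)[of y x] AD(1,5) by blast
    qed
    moreover have "S1 \<union> A \<subseteq> X" using S1(1) S2(3) AD(1) by (auto simp: X1_def)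
    moreover have "S2 \<union> D \<subseteq> Y" using S1(3) S2(1) AD(3) by (auto simp: Y2_def)
    moreover have "(t - B) + B = t" "(t - C) + C = t" using BC(3) CB by simp_all
    ultimately show ?thesis by metis
  qed
qed

subsection \<open>Lower regular pairs\<close>

text \<open>One-sided form of Szemeredi regularity. Without upper bounds on densities, a regular
  subpair comes from an extremal choice, with no partition of the vertex set.\<close>

definition lower_regular ::
    "real \<Rightarrow> real \<Rightarrow> ('a \<Rightarrow> 'b \<Rightarrow> bool) \<Rightarrow> 'a set \<Rightarrow> 'b set \<Rightarrow> bool" where
  "lower_regular \<epsilon> q E X Y \<longleftrightarrow> (\<forall>A\<subseteq>X. \<forall>B\<subseteq>Y.
     \<epsilon> * card X \<le> card A \<longrightarrow> \<epsilon> * card Y \<le> card B \<longrightarrow> q * card A * card B \<le> edge_count E A B)"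

lemma lower_regular_swap:
  "lower_regular \<epsilon> q E X Y \<Longrightarrow> lower_regular \<epsilon> q (\<lambda>y x. E x y) Y X"
  unfolding lower_regular_def by (subst edge_count_swap) (auto simp: mult_ac)

text \<open>An \<open>\<epsilon>\<close>-large part of an \<open>l\<close>-large subset is
  \<open>\<epsilon> * l\<close>-large in the whole. So parts may be shrunk for one edge without
  spoiling the edges treated before.\<close>

lemma lower_regular_subset:
  assumes reg: "lower_regular (\<epsilon> * l) q E X Y" and "0 \<le> \<epsilon>"
    and "A \<subseteq> X" "B \<subseteq> Y" "l * card X \<le> card A" "l * card Y \<le> card B"
  shows "lower_regular \<epsilon> q E A B"
  unfolding lower_regular_def
proof (intro allI impI)
  fix A' B' assume *: "A' \<subseteq> A" "B' \<subseteq> B" "\<epsilon> * card A \<le> card A'" "\<epsilon> * card B \<le> card B'"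
  have "\<epsilon> * (l * card X) \<le> \<epsilon> * card A" "\<epsilon> * (l * card Y) \<le> \<epsilon> * card B"
    using assms by (auto intro: mult_left_mono)
  then have "\<epsilon> * l * card X \<le> card A'" "\<epsilon> * l * card Y \<le> card B'"
    using * by (simp_all add: mult.assoc)
  moreover have "A' \<subseteq> X" "B' \<subseteq> Y" using * assms by auto
  ultimately show "q * card A' * card B' \<le> edge_count E A' B'"
    using reg unfolding lower_regular_def by blast
qed

lemma edge_count_nonneg: "0 \<le> edge_count E X Y"
  by (simp add: edge_count_def sum_nonneg)

lemma edge_count_le: "edge_count E X Y \<le> card X * card Y"
proof -
  have "edge_count E X Y \<le> (\<Sum>x\<in>X. \<Sum>y\<in>Y. 1)"
    unfolding edge_count_def by (intro sum_mono) auto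
  then show ?thesis by simp
qed

lemma edge_count_split:
  assumes "finite A" "finite B" "A' \<subseteq> A" "B' \<subseteq> B"
  shows "edge_count E A B = edge_count E A' B' + edge_count E A' (B - B') + edge_count E (A - A') B"
proof -
  have "edge_count E A B = edge_count E A' B + edge_count E (A - A') B"
    unfolding edge_count_def using sum.subset_diff[OF assms(3,1)] by (simp add: add.commute)
  moreover have "edge_count E A' B = edge_count E A' B' + edge_count E A' (B - B')"
    unfolding edge_count_def
    by (subst sum.subset_diff[OF assms(4,2)]) (simp add: sum.distrib)
  ultimately show ?thesis by simp
qed

text \<open>Weighted AM-GM for \<open>x\<close> and 1. The tangent bounds of two exponentials are
  combined with weights \<open>1 - \<kappa>\<close> and \<open>\<kappa>\<close>, for which the terms
  linear in \<open>u = ln x\<close> cancel.\<close>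

lemma powr_one_minus_le:
  fixes x \<kappa> :: real
  assumes "0 \<le> x" "0 \<le> \<kappa>" "\<kappa> \<le> 1"
  shows "x powr (1 - \<kappa>) \<le> x + \<kappa>"
proof (cases "x = 0")
  case False
  define u where "u = ln x"
  have x: "x = exp u" using False assms by (simp add: u_def)
  have "1 = (1 - \<kappa>) * (1 + \<kappa> * u) + \<kappa> * (1 + (\<kappa> - 1) * u)" by (simp add: algebra_simps)
  also have "\<dots> \<le> (1 - \<kappa>) * exp (\<kappa> * u) + \<kappa> * exp ((\<kappa> - 1) * u)"
    using assms by (intro add_mono mult_left_mono exp_ge_add_one_self) auto
  finally have "exp ((1 - \<kappa>) * u) * 1
      \<le> exp ((1 - \<kappa>) * u) * ((1 - \<kappa>) * exp (\<kappa> * u) + \<kappa> * exp ((\<kappa> - 1) * u))"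
    by (intro mult_left_mono) auto
  also have "\<dots> = (1 - \<kappa>) * exp ((1 - \<kappa>) * u + \<kappa> * u) + \<kappa> * exp ((1 - \<kappa>) * u + (\<kappa> - 1) * u)"
    by (simp only: exp_add distrib_left mult_ac)
  also have "\<dots> = (1 - \<kappa>) * x + \<kappa>" by (simp add: x algebra_simps)
  also have "\<dots> \<le> x + \<kappa>" using assms by (simp add: algebra_simps)
  finally show ?thesis by (simp add: x powr_def)
qed (use assms in simp)

text \<open>Maximising \<open>e(A, B) / (|A| |B|) powr (1 - \<kappa>)\<close> keeps both sides linear in size, and
  makes the edges outside any large sub-rectangle too few for it to be sparse.\<close>

lemma lower_regular_subpair:
  fixes p \<epsilon> \<eta> :: real
  assumes fin: "finite X" "finite Y" and ne: "X \<noteq> {}" "Y \<noteq> {}"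
    and p: "0 < p" and dens: "p * card X * card Y \<le> edge_count E X Y"
    and \<epsilon>: "0 < \<epsilon>" "\<epsilon> \<le> 1" and \<eta>: "0 < \<eta>" "\<eta> \<le> 1"
    and l: "l = p powr (2 / (\<eta> * \<epsilon>\<^sup>2))"
  obtains A B where "A \<subseteq> X" "B \<subseteq> Y" "l * card X \<le> card A" "l * card Y \<le> card B"
    "lower_regular \<epsilon> ((1 - \<eta>) * p) E A B"
proof -
  \<comment> \<open>Two rectangles outside \<open>A' \<times> B'\<close> will each cause an error
    \<open>\<kappa>\<close>. As \<open>A' \<times> B'\<close> has relative area at least
    \<open>\<epsilon>^2\<close>, both errors together are at most the share \<open>\<eta>\<close> of
    that area.\<close>
  define \<kappa> where "\<kappa> = \<eta> * \<epsilon>\<^sup>2 / 2"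
  have "\<epsilon>\<^sup>2 \<le> 1" using \<epsilon> by (intro power_le_one) auto
  then have "\<eta> * \<epsilon>\<^sup>2 \<le> 1 * 1" using \<eta> by (intro mult_mono) auto
  then have \<kappa>: "0 < \<kappa>" "\<kappa> \<le> 1 / 2" using \<epsilon> \<eta> by (auto simp: \<kappa>_def)
  define g where "g = (\<lambda>(A, B). edge_count E A B / (card A * card B) powr (1 - \<kappa>))"
  define P where "P = {(A, B). A \<subseteq> X \<and> B \<subseteq> Y \<and> A \<noteq> {} \<and> B \<noteq> {}}"
  have "P \<subseteq> Pow X \<times> Pow Y" by (auto simp: P_def)
  then have finP: "finite P" using fin finite_subset by blast
  have XY: "(X, Y) \<in> P" using ne by (auto simp: P_def)
  have "Max (g ` P) \<in> g ` P" using finP XY by (intro Max_in) auto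
  then obtain A B where AB: "(A, B) \<in> P" "g (A, B) = Max (g ` P)" by force
  have max: "g z \<le> g (A, B)" if "z \<in> P" for z
    unfolding AB(2) using that finP by (intro Max_ge) auto
  have sub: "A \<subseteq> X" "B \<subseteq> Y" "A \<noteq> {}" "B \<noteq> {}" using AB by (auto simp: P_def)
  then have finAB: "finite A" "finite B" using fin finite_subset by auto
  define e where "e = edge_count E A B"
  define M where "M = real (card A) * card B"
  define N where "N = real (card X) * card Y"
  have pos: "0 < real (card A)" "0 < real (card B)" "0 < real (card X)" "0 < real (card Y)"
    using finAB fin sub ne by (auto simp: card_gt_0_iff)
  then have MN: "0 < M" "0 < N" by (auto simp: M_def N_def)
  have cAX: "real (card A) \<le> card X" "real (card B) \<le> card Y"
    using sub fin by (auto intro: card_mono)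
  then have "M \<le> N" unfolding M_def N_def by (intro mult_mono) auto
  have gm: "edge_count E A' B' \<le> e * ((card A' * card B') / M + \<kappa>)" if "A' \<subseteq> A" "B' \<subseteq> B" for A' B'
  proof (cases "A' = {} \<or> B' = {}")
    case True
    then show ?thesis using \<kappa> edge_count_nonneg[of E A B] by (auto simp: edge_count_def e_def)
  next
    case False
    then have "(A', B') \<in> P" using that sub by (auto simp: P_def)
    define m where "m = real (card A') * card B'"
    have "finite A'" "finite B'" using that finAB finite_subset by auto
    then have m: "0 < m" using False by (simp add: m_def card_gt_0_iff)
    have "edge_count E A' B' / m powr (1 - \<kappa>) \<le> e / M powr (1 - \<kappa>)"
      using max[OF \<open>(A', B') \<in> P\<close>] by (simp add: g_def m_def M_def e_def)
    then have "edge_count E A' B' \<le> e / M powr (1 - \<kappa>) * m powr (1 - \<kappa>)"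
      using m by (simp add: pos_divide_le_eq)
    also have "\<dots> = e * (m / M) powr (1 - \<kappa>)" using m MN by (simp add: powr_divide)
    also have "\<dots> \<le> e * (m / M + \<kappa>)"
      using m MN \<kappa> edge_count_nonneg[of E A B]
      by (intro mult_left_mono powr_one_minus_le) (auto simp: e_def)
    finally show ?thesis by (simp add: m_def)
  qed
  have gXY: "p * N powr \<kappa> \<le> e / M powr (1 - \<kappa>)"
  proof -
    have "p * N powr \<kappa> = p * N / N powr (1 - \<kappa>)"
      using MN by (simp add: powr_diff)
    also have "\<dots> \<le> edge_count E X Y / N powr (1 - \<kappa>)"
      using dens by (intro divide_right_mono) (auto simp: N_def mult.assoc)
    also have "\<dots> \<le> e / M powr (1 - \<kappa>)"
      using max[OF XY] by (simp add: g_def N_def M_def e_def)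
    finally show ?thesis .
  qed
  \<comment> \<open>Comparing the trivial bound \<open>e \<le> M\<close> with the value of
    \<open>g\<close> at \<open>(X, Y)\<close> forces \<open>M\<close> to be at least
    \<open>p powr (1 / \<kappa>) * N\<close>.\<close>
  have "e / M powr (1 - \<kappa>) \<le> M / M powr (1 - \<kappa>)"
    using edge_count_le[of E A B] by (intro divide_right_mono) (auto simp: e_def M_def)
  also have "\<dots> = M powr \<kappa>" using MN by (simp add: powr_diff)
  finally have "p * N powr \<kappa> \<le> M powr \<kappa>" using gXY by linarith
  then have root_le: "(p * N powr \<kappa>) powr (1 / \<kappa>) \<le> (M powr \<kappa>) powr (1 / \<kappa>)"
    using p \<kappa> by (intro powr_mono2) auto
  have lMN: "l * N \<le> M"
  proof -
    have "l = p powr (1 / \<kappa>)" by (simp add: l \<kappa>_def)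
    then show ?thesis
      using root_le p MN \<kappa> by (simp add: powr_mult powr_powr)
  qed
  have l0: "0 \<le> l" by (simp add: l)
  have lA: "l * card X \<le> card A"
  proof -
    have "(l * card X) * card Y \<le> real (card A) * card B" using lMN by (simp add: M_def N_def mult.assoc)
    also have "\<dots> \<le> card A * real (card Y)" using cAX by (intro mult_left_mono) auto
    finally show ?thesis using pos by simp
  qed
  have lB: "l * card Y \<le> card B"
  proof -
    have "(l * card Y) * card X \<le> real (card A) * card B" using lMN by (simp add: M_def N_def mult_ac)
    also have "\<dots> \<le> card B * real (card X)"
      using mult_right_mono[OF cAX(1), of "card B"] by (simp add: mult.commute)
    finally show ?thesis using pos by simp
  qed
  have e: "p * M \<le> e"
  proof -
    have "p * M powr \<kappa> \<le> p * N powr \<kappa>"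
      using \<open>M \<le> N\<close> MN \<kappa> p by (intro mult_left_mono powr_mono2) auto
    then have "p * M powr \<kappa> \<le> e / M powr (1 - \<kappa>)" using gXY by linarith
    then have "p * M powr \<kappa> * M powr (1 - \<kappa>) \<le> e" using MN by (simp add: pos_le_divide_eq)
    then show ?thesis using MN by (simp add: mult.assoc flip: powr_add)
  qed
  have "lower_regular \<epsilon> ((1 - \<eta>) * p) E A B"
    unfolding lower_regular_def
  proof (intro allI impI)
    fix A' B' assume *: "A' \<subseteq> A" "B' \<subseteq> B" "\<epsilon> * card A \<le> card A'" "\<epsilon> * card B \<le> card B'"
    define m where "m = real (card A') * card B'"
    have "(\<epsilon> * card A) * (\<epsilon> * card B) \<le> m"
      unfolding m_def using * \<epsilon> by (intro mult_mono) auto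
    then have "\<epsilon>\<^sup>2 * M \<le> m" by (simp add: M_def power2_eq_square mult_ac)
    then have "\<epsilon>\<^sup>2 \<le> m / M" using MN by (simp add: pos_le_divide_eq)
    then have "\<eta> * \<epsilon>\<^sup>2 \<le> \<eta> * (m / M)" using \<eta> by (intro mult_left_mono) auto
    then have 1: "(1 - \<eta>) * (m / M) \<le> m / M - 2 * \<kappa>"
      unfolding left_diff_distrib \<kappa>_def by simp
    have cB: "real (card (B - B')) = card B - real (card B')" "real (card (A - A')) = card A - real (card A')"
      using * finAB by (auto simp: card_Diff_subset finite_subset card_mono of_nat_diff)
    \<comment> \<open>The complement of \<open>A' \<times> B'\<close> in \<open>A \<times> B\<close>
      is cut into two rectangles of relative areas \<open>u\<close> and \<open>v\<close>. By
      maximality neither contains much more than its share of the edges.\<close>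
    define u where "u = (card A' * card (B - B')) / M"
    define v where "v = (card (A - A') * card B) / M"
    have "edge_count E A' (B - B') \<le> e * (u + \<kappa>)"
      unfolding u_def using * by (intro gm) auto
    moreover have "edge_count E (A - A') B \<le> e * (v + \<kappa>)"
      unfolding v_def by (intro gm) auto
    moreover have uv: "u + v = 1 - m / M"
      using MN unfolding u_def v_def of_nat_mult cB
      by (simp add: field_simps) (simp add: m_def M_def algebra_simps)
    have "e * (m / M - 2 * \<kappa>) = e - (e * (u + \<kappa>) + e * (v + \<kappa>))"
    proof -
      have mM: "m / M = 1 - (u + v)" using uv by simp
      show ?thesis unfolding mM by (simp add: algebra_simps)
    qed
    ultimately have "e * (m / M - 2 * \<kappa>) \<le> edge_count E A' B'"
      using edge_count_split[OF finAB *(1,2), of E] unfolding e_def[symmetric] by linarith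
    moreover have "e * ((1 - \<eta>) * (m / M)) \<le> e * (m / M - 2 * \<kappa>)"
      using 1 edge_count_nonneg[of E A B] by (intro mult_left_mono) (auto simp: e_def)
    moreover have "(p * M) * ((1 - \<eta>) * (m / M)) \<le> e * ((1 - \<eta>) * (m / M))"
      using e \<eta> MN by (intro mult_right_mono) (auto simp: m_def)
    moreover have "(p * M) * ((1 - \<eta>) * (m / M)) = (1 - \<eta>) * p * card A' * card B'"
      using MN by (simp add: m_def)
    ultimately show "(1 - \<eta>) * p * card A' * card B' \<le> edge_count E A' B'" by linarith
  qed
  then show thesis using that[of A B] sub lA lB by blast
qed

lemma popular_colour:
  fixes f :: "'a \<Rightarrow> 'b \<Rightarrow> nat"
  assumes r: "0 < r" and f: "\<And>x y. x \<in> X \<Longrightarrow> y \<in> Y \<Longrightarrow> f x y < r"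
  obtains k where "k < r" "1 / r * card X * card Y \<le> edge_count (\<lambda>x y. f x y = k) X Y"
proof -
  have "(\<Sum>k<r. edge_count (\<lambda>x y. f x y = k) X Y) = (\<Sum>x\<in>X. \<Sum>y\<in>Y. \<Sum>k<r. of_bool (f x y = k))"
    unfolding edge_count_def by (subst sum.swap, rule sum.cong[OF refl], subst sum.swap) simp
  also have "\<dots> = (\<Sum>x\<in>X. \<Sum>y\<in>Y. 1)"
    using f by (intro sum.cong refl) (simp add: of_bool_def)
  finally have total: "(\<Sum>k<r. edge_count (\<lambda>x y. f x y = k) X Y) = card X * card Y" by simp
  have "\<exists>k<r. 1 / r * card X * card Y \<le> edge_count (\<lambda>x y. f x y = k) X Y"
  proof (rule ccontr)
    assume "\<not> ?thesis"
    then have "(\<Sum>k<r. edge_count (\<lambda>x y. f x y = k) X Y) < (\<Sum>k<r. 1 / r * card X * card Y)"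
      using r by (intro sum_strict_mono) force+
    then show False using total r by simp
  qed
  then show thesis using that by blast
qed

text \<open>Induction on the edges. Treating a new edge shrinks its two parts by the factor
  \<open>l1\<close>, so the induction hypothesis is invoked with \<open>\<epsilon> * l1\<close>, and
  \<open>lower_regular_subset\<close> restores \<open>\<epsilon>\<close> for the older
  edges.\<close>

lemma edgewise_lower_regular:
  fixes F :: "'a set set" and r :: nat and \<eta> :: real
  assumes "finite F" "\<And>e. e \<in> F \<Longrightarrow> card e = 2" and r: "0 < r" and \<eta>: "0 < \<eta>" "\<eta> \<le> 1"
    and "0 < \<epsilon>" "\<epsilon> \<le> 1"
  shows "\<exists>l>0. \<forall>n\<ge>1. \<forall>c.
    (\<forall>u v i j. {u, v} \<in> F \<longrightarrow> i < n \<longrightarrow> j < n \<longrightarrow> c {(u, i), (v, j)} < r) \<longrightarrow>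
    (\<exists>W k. (\<forall>v. W v \<subseteq> {..<n} \<and> l * real n \<le> card (W v)) \<and> (\<forall>e\<in>F. k e < r) \<and>
      (\<forall>u v. {u, v} \<in> F \<longrightarrow>
        lower_regular \<epsilon> ((1 - \<eta>) * (1 / r)) (\<lambda>i j. c {(u, i), (v, j)} = k {u, v}) (W u) (W v)))"
  using assms(1,2,6,7)
proof (induction F arbitrary: \<epsilon>)
  case empty
  show ?case
  proof (rule exI[of _ 1], intro conjI allI impI)
    fix n :: nat and c :: "('a \<times> nat) set \<Rightarrow> nat"
    show "\<exists>W k. (\<forall>v. W v \<subseteq> {..<n} \<and> 1 * real n \<le> card (W v)) \<and> (\<forall>e\<in>{}. k e < r) \<and>
      (\<forall>u v. {u, v} \<in> {} \<longrightarrow>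
        lower_regular \<epsilon> ((1 - \<eta>) * (1 / r)) (\<lambda>i j. c {(u, i), (v, j)} = k {u, v}) (W u) (W v))"
      by (rule exI[of _ "\<lambda>_. {..<n}"]) simp
  qed simp
next
  case (insert e F)
  define l1 where "l1 = (1 / real r) powr (2 / (\<eta> * \<epsilon>\<^sup>2))"
  have "l1 \<le> 1 powr (2 / (\<eta> * \<epsilon>\<^sup>2))"
    unfolding l1_def using r \<eta> by (intro powr_mono2) (auto simp: field_simps)
  then have l1: "0 < l1" "l1 \<le> 1" using r by (auto simp: l1_def)
  have \<epsilon>l: "0 < \<epsilon> * l1" "\<epsilon> * l1 \<le> 1"
    using insert.prems l1 by (auto simp: mult_le_one)
  obtain l0 where l0: "0 < l0" and reg0: "\<forall>n\<ge>1. \<forall>c.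
    (\<forall>u v i j. {u, v} \<in> F \<longrightarrow> i < n \<longrightarrow> j < n \<longrightarrow> c {(u, i), (v, j)} < r) \<longrightarrow>
    (\<exists>W k. (\<forall>v. W v \<subseteq> {..<n} \<and> l0 * real n \<le> card (W v)) \<and> (\<forall>e\<in>F. k e < r) \<and>
      (\<forall>u v. {u, v} \<in> F \<longrightarrow>
        lower_regular (\<epsilon> * l1) ((1 - \<eta>) * (1 / r)) (\<lambda>i j. c {(u, i), (v, j)} = k {u, v}) (W u) (W v)))"
    using insert.IH[OF _ \<epsilon>l] insert.prems(1) by auto
  obtain a b where e: "e = {a, b}" "a \<noteq> b"
    using insert.prems(1)[of e] by (auto simp: card_2_iff)
  show ?case
  proof (intro exI[of _ "l0 * l1"] conjI allI impI)
    show "0 < l0 * l1" using l0 l1 by simp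
    fix n :: nat and c
    assume n: "1 \<le> n" and c: "\<forall>u v i j. {u, v} \<in> insert e F \<longrightarrow> i < n \<longrightarrow> j < n \<longrightarrow> c {(u, i), (v, j)} < r"
    then have cF: "\<forall>u v i j. {u, v} \<in> F \<longrightarrow> i < n \<longrightarrow> j < n \<longrightarrow> c {(u, i), (v, j)} < r"
      by blast
    obtain W k where Wk: "\<forall>v. W v \<subseteq> {..<n} \<and> l0 * real n \<le> card (W v)" "\<forall>e\<in>F. k e < r"
      "\<forall>u v. {u, v} \<in> F \<longrightarrow>
        lower_regular (\<epsilon> * l1) ((1 - \<eta>) * (1 / r)) (\<lambda>i j. c {(u, i), (v, j)} = k {u, v}) (W u) (W v)"
      using mp[OF spec[OF mp[OF spec[OF reg0] n]] cF] by (elim exE conjE)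
    have W: "W v \<subseteq> {..<n}" "l0 * real n \<le> card (W v)" for v
      using Wk(1) by auto
    have k: "k e < r" if "e \<in> F" for e
      using Wk(2) that by blast
    have reg: "lower_regular (\<epsilon> * l1) ((1 - \<eta>) * (1 / r)) (\<lambda>i j. c {(u, i), (v, j)} = k {u, v}) (W u) (W v)"
      if "{u, v} \<in> F" for u v
      using Wk(3) that by blast
    have finW: "finite (W v)" for v using W(1) finite_subset by blast
    have neW: "W v \<noteq> {}" for v
    proof
      assume "W v = {}"
      then have "l0 * real n \<le> 0" using W(2)[of v] by simp
      then show False using l0 n by (simp add: mult_le_0_iff)
    qed
    have "c {(a, i), (b, j)} < r" if "i \<in> W a" "j \<in> W b" for i j
      using that c e W(1) by blast
    then obtain k0 where k0: "k0 < r"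
      "1 / r * card (W a) * card (W b) \<le> edge_count (\<lambda>i j. c {(a, i), (b, j)} = k0) (W a) (W b)"
      using popular_colour[OF r, of "W a" "W b" "\<lambda>i j. c {(a, i), (b, j)}"] by blast
    obtain A B where AB: "A \<subseteq> W a" "B \<subseteq> W b" "l1 * card (W a) \<le> card A" "l1 * card (W b) \<le> card B"
      "lower_regular \<epsilon> ((1 - \<eta>) * (1 / r)) (\<lambda>i j. c {(a, i), (b, j)} = k0) A B"
      using lower_regular_subpair[OF finW finW neW neW _ k0(2) insert.prems(2,3) \<eta> l1_def] r by auto
    define W' where "W' = W(a := A, b := B)"
    have W': "W' v \<subseteq> W v" "l1 * card (W v) \<le> card (W' v)" for v
      using AB e l1 by (auto simp: W'_def mult_left_le_one_le)
    show "\<exists>W k. (\<forall>v. W v \<subseteq> {..<n} \<and> l0 * l1 * real n \<le> card (W v)) \<and> (\<forall>e\<in>insert e F. k e < r) \<and>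
      (\<forall>u v. {u, v} \<in> insert e F \<longrightarrow>
        lower_regular \<epsilon> ((1 - \<eta>) * (1 / r)) (\<lambda>i j. c {(u, i), (v, j)} = k {u, v}) (W u) (W v))"
    proof (intro exI[of _ W'] exI[of _ "k(e := k0)"] conjI allI ballI impI)
      fix v
      show "W' v \<subseteq> {..<n}" using W W' by blast
      have "l1 * (l0 * real n) \<le> l1 * card (W v)" using W l1 by (intro mult_left_mono) auto
      then show "l0 * l1 * real n \<le> card (W' v)" using W'(2)[of v] by (simp add: mult_ac)
    next
      fix f assume "f \<in> insert e F"
      then show "(k(e := k0)) f < r" using k0 k by auto
    next
      fix u v assume uv: "{u, v} \<in> insert e F"
      show "lower_regular \<epsilon> ((1 - \<eta>) * (1 / r))
        (\<lambda>i j. c {(u, i), (v, j)} = (k(e := k0)) {u, v}) (W' u) (W' v)"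
      proof (cases "{u, v} = e")
        case True
        then consider "u = a" "v = b" | "u = b" "v = a" using e by (auto simp: doubleton_eq_iff)
        then show ?thesis
        proof cases
          case 1
          then show ?thesis using AB e by (simp add: W'_def)
        next
          case 2
          then show ?thesis using lower_regular_swap[OF AB(5)] e
            by (simp add: W'_def insert_commute)
        qed
      next
        case False
        then have "{u, v} \<in> F" "(k(e := k0)) {u, v} = k {u, v}" using uv by auto
        then show ?thesis
          using insert.prems W' lower_regular_subset[OF reg, of u v "W' u" "W' v"] by simp
      qed
    qed
  qed
qed

subsection \<open>Embedding a blowup into a regular system\<close>

text \<open>\<open>R u v\<close> stands for having the common colour between the parts
  \<open>X u\<close> and \<open>X v\<close>. The bound on \<open>\<epsilon>\<close> serves twice:
  candidate sets stay large enough for regularity to apply, and bad vertices take up at most the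
  share \<open>\<eta> / 2\<close> of the guaranteed size of a candidate set.\<close>

locale regular_system =
  fixes V :: "'b set" and Ed :: "'b set set" and X :: "'b \<Rightarrow> 'c set"
    and R :: "'b \<Rightarrow> 'b \<Rightarrow> 'c \<Rightarrow> 'c \<Rightarrow> bool" and q \<epsilon> \<eta> :: real
  assumes finV: "finite V" and Ed: "\<And>e. e \<in> Ed \<Longrightarrow> e \<subseteq> V \<and> card e = 2"
    and finX: "\<And>v. finite (X v)" and neX: "\<And>v. X v \<noteq> {}"
    and R_sym: "\<And>u v i j. R u v i j \<Longrightarrow> R v u j i"
    and reg: "\<And>u v. {u, v} \<in> Ed \<Longrightarrow> lower_regular \<epsilon> q (R u v) (X u) (X v)"
    and q: "0 < q" "q \<le> 1" and \<eta>: "0 < \<eta>" "\<eta> < 1"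
    and \<epsilon>: "0 < \<epsilon>" "card V * \<epsilon> \<le> \<eta> / 2 * q ^ card V"
begin

definition cand :: "'b set \<Rightarrow> ('b \<Rightarrow> 'c) \<Rightarrow> 'b \<Rightarrow> 'c set" where
  "cand P x z = {w\<in>X z. \<forall>u\<in>P. {u, z} \<in> Ed \<longrightarrow> R u z (x u) w}"

definition back_deg :: "'b set \<Rightarrow> 'b \<Rightarrow> nat" where
  "back_deg P z = card {u\<in>P. {u, z} \<in> Ed}"

definition good :: "'b set \<Rightarrow> ('b \<Rightarrow> 'c) \<Rightarrow> bool" where
  "good P x \<longleftrightarrow> (\<forall>z\<in>V - P. q ^ back_deg P z * card (X z) \<le> card (cand P x z))"

text \<open>Avoiding these vertices preserves \<open>good\<close>: each open candidate set then
  loses at most the factor \<open>q\<close> per embedded neighbour.\<close>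

definition bad :: "'b set \<Rightarrow> ('b \<Rightarrow> 'c) \<Rightarrow> 'b \<Rightarrow> 'c set" where
  "bad P x z = {w\<in>X z. \<exists>z'\<in>V - P - {z}. {z, z'} \<in> Ed \<and>
     card {w'\<in>cand P x z'. R z z' w w'} < q * card (cand P x z')}"

lemma not_loop: "{z, z} \<notin> Ed"
proof
  assume "{z, z} \<in> Ed"
  then have "card {z, z} = 2" using Ed by blast
  then show False by simp
qed

lemma cand_subset: "cand P x z \<subseteq> X z"
  by (auto simp: cand_def)

lemma finite_cand: "finite (cand P x z)"
  by (rule finite_subset[OF cand_subset finX])

lemma back_deg_le: "P \<subseteq> V \<Longrightarrow> back_deg P z \<le> card V"
  unfolding back_deg_def using finV by (intro card_mono) auto

lemma good_extend:
  assumes P: "P \<subseteq> V" and "good P x" and z: "z \<in> V - P" and w: "w \<in> X z - bad P x z"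
  shows "good (insert z P) (x(z := w))"
  unfolding good_def
proof
  fix z' assume z': "z' \<in> V - insert z P"
  have zP: "z \<notin> P" using z by simp
  have finP: "finite P" using finite_subset[OF P finV] .
  have g: "q ^ back_deg P z' * card (X z') \<le> card (cand P x z')"
    using assms(2) z' by (auto simp: good_def)
  show "q ^ back_deg (insert z P) z' * card (X z') \<le> card (cand (insert z P) (x(z := w)) z')"
  proof (cases "{z, z'} \<in> Ed")
    case True
    have "{u \<in> insert z P. {u, z'} \<in> Ed} = insert z {u\<in>P. {u, z'} \<in> Ed}" using True by auto
    then have "back_deg (insert z P) z' = Suc (back_deg P z')"
      using zP finP by (simp add: back_deg_def)
    moreover have "cand (insert z P) (x(z := w)) z' = {w'\<in>cand P x z'. R z z' w w'}"
      using True zP by (auto simp: cand_def)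
    moreover have "q * card (cand P x z') \<le> card {w'\<in>cand P x z'. R z z' w w'}"
      using w z' True by (auto simp: bad_def not_less)
    moreover have "q * (q ^ back_deg P z' * card (X z')) \<le> q * card (cand P x z')"
      using g q by (intro mult_left_mono) auto
    ultimately show ?thesis by simp
  next
    case False
    then have "{u \<in> insert z P. {u, z'} \<in> Ed} = {u\<in>P. {u, z'} \<in> Ed}" by auto
    then have "back_deg (insert z P) z' = back_deg P z'" by (simp add: back_deg_def)
    moreover have "cand (insert z P) (x(z := w)) z' = cand P x z'"
      using False zP by (auto simp: cand_def)
    ultimately show ?thesis using g by simp
  qed
qed

text \<open>The vertices that are bad because of a single \<open>z'\<close> would form a pair of
  density below \<open>q\<close> with the candidates of \<open>z'\<close>, so lower regularity makes
  them few. Summing over \<open>z'\<close> gives the factor \<open>card V\<close>.\<close>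

lemma card_bad_le:
  assumes P: "P \<subseteq> V" and g: "good P x" and z: "z \<in> V - P"
  shows "card (bad P x z) \<le> card V * \<epsilon> * card (X z)"
proof -
  define D where "D z' = {w\<in>X z. card {w'\<in>cand P x z'. R z z' w w'} < q * card (cand P x z')}" for z'
  define Z where "Z = {z'\<in>V - P - {z}. {z, z'} \<in> Ed}"
  have finZ: "finite Z" "card Z \<le> card V"
    using finV by (auto simp: Z_def intro!: card_mono)
  have "\<eta> / 2 * q ^ card V \<le> 1 * q ^ card V" using \<eta> q by (intro mult_right_mono) auto
  moreover have "1 \<le> card V" using z finV by (metis DiffD1 One_nat_def Suc_leI card_gt_0_iff empty_iff)
  then have "1 * \<epsilon> \<le> card V * \<epsilon>" using \<epsilon> by (intro mult_right_mono) auto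
  ultimately have \<epsilon>q: "\<epsilon> \<le> q ^ card V" using \<epsilon> by linarith
  have D: "card (D z') \<le> \<epsilon> * card (X z)" if z': "z' \<in> Z" for z'
  proof (rule ccontr)
    assume "\<not> ?thesis"
    then have large: "\<epsilon> * card (X z) < card (D z')" by simp
    have finD: "finite (D z')" "D z' \<subseteq> X z" using finX by (auto simp: D_def)
    have "q ^ card V \<le> q ^ back_deg P z'"
      using q back_deg_le[OF P] by (intro power_decreasing) auto
    then have "\<epsilon> * card (X z') \<le> q ^ back_deg P z' * card (X z')"
      using \<epsilon>q by (intro mult_right_mono) auto
    also have "\<dots> \<le> card (cand P x z')" using g z' by (auto simp: good_def Z_def)
    finally have "q * card (D z') * card (cand P x z') \<le> edge_count (R z z') (D z') (cand P x z')"
      using reg[of z z'] z' large finD(2) cand_subset unfolding lower_regular_def Z_def by simp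
    also have "\<dots> = (\<Sum>w\<in>D z'. real (card {w'\<in>cand P x z'. R z z' w w'}))"
      unfolding edge_count_def using finite_cand by (intro sum.cong refl) (simp add: Int_def)
    also have "\<dots> < (\<Sum>w\<in>D z'. q * card (cand P x z'))"
    proof (rule sum_strict_mono)
      show "D z' \<noteq> {}"
      proof
        assume "D z' = {}"
        then have "\<epsilon> * card (X z) < 0" using large by simp
        then show False using \<epsilon> by (simp add: mult_less_0_iff)
      qed
    qed (use finD in \<open>auto simp: D_def\<close>)
    finally show False by (simp add: mult_ac)
  qed
  have "bad P x z = (\<Union>z'\<in>Z. D z')" by (auto simp: bad_def D_def Z_def)
  then have "card (bad P x z) \<le> (\<Sum>z'\<in>Z. card (D z'))"
    using card_UN_le[OF finZ(1)] by simp
  then have "real (card (bad P x z)) \<le> (\<Sum>z'\<in>Z. real (card (D z')))"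
    by (metis of_nat_le_iff of_nat_sum)
  also have "\<dots> \<le> (\<Sum>z'\<in>Z. \<epsilon> * card (X z))" using D by (intro sum_mono) auto
  also have "\<dots> \<le> card V * (\<epsilon> * card (X z))"
    using finZ \<epsilon> by (simp add: mult_right_mono)
  finally show ?thesis by (simp add: mult.assoc)
qed

lemma card_good_cand_ge:
  assumes P: "P \<subseteq> V" and g: "good P x" and z: "z \<in> V - P"
  shows "(1 - \<eta> / 2) * q ^ back_deg P z * card (X z) \<le> card (cand P x z - bad P x z)"
proof -
  have "card V * \<epsilon> * card (X z) \<le> \<eta> / 2 * q ^ card V * card (X z)"
    using \<epsilon> by (intro mult_right_mono) auto
  also have "\<dots> \<le> \<eta> / 2 * q ^ back_deg P z * card (X z)"
    using q \<eta> back_deg_le[OF P] by (intro mult_right_mono mult_left_mono power_decreasing) auto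
  finally have "card (bad P x z) \<le> \<eta> / 2 * q ^ back_deg P z * card (X z)"
    using card_bad_le[OF assms] by linarith
  moreover have "q ^ back_deg P z * card (X z) \<le> card (cand P x z)"
    using g z by (simp add: good_def)
  moreover have "card (cand P x z) \<le> card (cand P x z - bad P x z) + card (bad P x z)"
  proof -
    have "finite (bad P x z)" using finX by (simp add: bad_def)
    then have "card (cand P x z) \<le> card ((cand P x z - bad P x z) \<union> bad P x z)"
      using finite_cand by (intro card_mono) auto
    then show ?thesis using card_Un_le le_trans by blast
  qed
  ultimately show ?thesis by (simp add: left_diff_distrib)
qed

text \<open>\<open>x i\<close> is the \<open>i\<close>-th partial embedding: for \<open>J = {..<t}\<close> and \<open>P = V\<close> the family forms a
  \<open>t\<close>-blowup. Goodness of the single embeddings is what allows the family to be extended.\<close>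

definition tuples :: "'b set \<Rightarrow> nat set \<Rightarrow> (nat \<Rightarrow> 'b \<Rightarrow> 'c) \<Rightarrow> bool" where
  "tuples P J x \<longleftrightarrow> P \<subseteq> V \<and> finite J \<and> (\<forall>i\<in>J. good P (x i)) \<and>
     (\<forall>u\<in>P. inj_on (\<lambda>i. x i u) J \<and> (\<forall>i\<in>J. x i u \<in> X u)) \<and>
     (\<forall>u\<in>P. \<forall>v\<in>P. {u, v} \<in> Ed \<longrightarrow> (\<forall>i\<in>J. \<forall>j\<in>J. R u v (x i u) (x j v)))"

text \<open>Each \<open>w\<close> in \<open>W\<close> is a candidate for all indices in
  \<open>J'\<close> at once. Hence any injection of \<open>J'\<close> into \<open>W\<close> provides
  the edges between different indices \<open>i\<close> and \<open>j\<close> as well.\<close>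

lemma tuples_extend_pattern:
  assumes T: "tuples P J x" and z: "z \<in> V - P" and J': "J' \<subseteq> J"
    and W: "\<And>w. w \<in> W \<Longrightarrow> w \<in> X z \<and> (\<forall>i\<in>J'. w \<in> cand P (x i) z - bad P (x i) z)"
    and W': "finite W" "card J' \<le> card W"
  shows "\<exists>x'. tuples (insert z P) J' x'"
proof -
  have finJ: "finite J'" using T J' finite_subset by (auto simp: tuples_def)
  obtain g where g: "inj_on g J'" "g ` J' \<subseteq> W"
    using card_le_inj[OF finJ W'] by auto
  define x' where "x' i = (x i)(z := g i)" for i
  have gW: "g i \<in> W" if "i \<in> J'" for i using g that by auto
  have zP: "z \<notin> P" using z by simp
  have "tuples (insert z P) J' x'"
    unfolding tuples_def
  proof (intro conjI ballI impI)
    show "insert z P \<subseteq> V" using T z by (auto simp: tuples_def)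
    show "finite J'" by (rule finJ)
    show "good (insert z P) (x' i)" if "i \<in> J'" for i
      unfolding x'_def using T z J' that W[OF gW[OF that]]
      by (intro good_extend) (auto simp: tuples_def)
    show "inj_on (\<lambda>i. x' i u) J'" if "u \<in> insert z P" for u
    proof (cases "u = z")
      case True
      then show ?thesis using g by (simp add: x'_def)
    next
      case False
      then have "inj_on (\<lambda>i. x i u) J" using that T by (auto simp: tuples_def)
      then show ?thesis using False J' by (auto simp: x'_def intro: inj_on_subset)
    qed
    show "x' i u \<in> X u" if "u \<in> insert z P" "i \<in> J'" for u i
      using that T J' W[OF gW[OF that(2)]] by (auto simp: tuples_def x'_def)
    fix u v i j
    assume uv: "u \<in> insert z P" "v \<in> insert z P" "{u, v} \<in> Ed" and ij: "i \<in> J'" "j \<in> J'"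
    have *: "R u z (x i u) (g j)" if "u \<in> P" "{u, z} \<in> Ed" "i \<in> J'" "j \<in> J'" for u i j
      using that W[OF gW[OF that(4)]] by (auto simp: cand_def)
    consider "u = z" "v = z" | "u \<in> P" "v = z" | "u = z" "v \<in> P" | "u \<in> P" "v \<in> P"
      using uv by auto
    then show "R u v (x' i u) (x' j v)"
    proof cases
      case 1
      then show ?thesis using uv not_loop by auto
    next
      case 2
      then show ?thesis using *[of u i j] uv ij zP by (auto simp: x'_def)
    next
      case 3
      then show ?thesis using *[of v j i] uv ij zP by (auto simp: x'_def insert_commute intro: R_sym)
    next
      case 4
      then have "R u v (x i u) (x j v)" using T uv(3) ij J' unfolding tuples_def by blast
      moreover have "u \<noteq> z" "v \<noteq> z" using 4 zP by auto
      ultimately show ?thesis by (simp add: x'_def)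
    qed
  qed
  then show ?thesis by blast
qed

text \<open>The vertices \<open>w\<close> of \<open>X z\<close> are classified by the set of indices for which they extend the
  partial embedding. On average this set contains a proportion \<open>q ^ back_deg P z\<close> of \<open>J\<close>, and some
  large set \<open>J'\<close> is shared by so many \<open>w\<close> that each index in \<open>J'\<close> gets a vertex of its own.\<close>

lemma tuples_step:
  assumes T: "tuples P J x" and z: "z \<in> V - P"
    and big: "card J * 2 ^ card J \<le> \<eta> / 2 * q ^ card V * card (X z)"
  shows "\<exists>J' x'. J' \<subseteq> J \<and> tuples (insert z P) J' x' \<and>
    (1 - \<eta>) * q ^ back_deg P z * card J \<le> card J'"
proof (cases "J = {}")
  case True
  then show ?thesis using tuples_extend_pattern[OF T z, of "{}" "{}"] by auto
next
  case False
  have P: "P \<subseteq> V" and finJ: "finite J" and g: "\<And>i. i \<in> J \<Longrightarrow> good P (x i)"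
    using T by (auto simp: tuples_def)
  have J0: "0 < real (card J)" using False finJ by (simp add: card_gt_0_iff)
  define d where "d = q ^ back_deg P z"
  define pat where "pat w = {i\<in>J. w \<in> cand P (x i) z - bad P (x i) z}" for w
  define Y where "Y = {w\<in>X z. (1 - \<eta>) * d * card J \<le> card (pat w)}"
  have finY: "finite Y" "Y \<subseteq> X z" using finX by (auto simp: Y_def)
  have d0: "0 < d" using q by (simp add: d_def)
  have "card J * ((1 - \<eta> / 2) * d * card (X z)) = (\<Sum>i\<in>J. (1 - \<eta> / 2) * d * card (X z))" by simp
  also have "\<dots> \<le> (\<Sum>i\<in>J. real (card {w\<in>X z. w \<in> cand P (x i) z - bad P (x i) z}))"
  proof (rule sum_mono)
    fix i assume i: "i \<in> J"
    have "{w\<in>X z. w \<in> cand P (x i) z - bad P (x i) z} = cand P (x i) z - bad P (x i) z"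
      using cand_subset by auto
    then show "(1 - \<eta> / 2) * d * card (X z) \<le> card {w\<in>X z. w \<in> cand P (x i) z - bad P (x i) z}"
      using card_good_cand_ge[OF P g[OF i] z] by (simp add: d_def)
  qed
  also have "\<dots> = real (\<Sum>w\<in>X z. card (pat w))"
    unfolding pat_def of_nat_sum[symmetric]
    using sum_multicount_gen[OF finX[of z] finJ, of "\<lambda>w i. w \<in> cand P (x i) z - bad P (x i) z" "\<lambda>i. card {w\<in>X z. w \<in> cand P (x i) z - bad P (x i) z}"]
    by simp
  also have "\<dots> = (\<Sum>w\<in>Y. real (card (pat w))) + (\<Sum>w\<in>X z - Y. real (card (pat w)))"
    using sum.subset_diff[OF finY(2) finX, of "\<lambda>w. real (card (pat w))"] by simp
  finally have count: "card J * ((1 - \<eta> / 2) * d * card (X z))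
    \<le> (\<Sum>w\<in>Y. real (card (pat w))) + (\<Sum>w\<in>X z - Y. real (card (pat w)))" .
  have "(\<Sum>w\<in>Y. real (card (pat w))) \<le> (\<Sum>w\<in>Y. real (card J))"
    using finJ by (intro sum_mono) (auto simp: pat_def intro!: card_mono)
  moreover have "(\<Sum>w\<in>X z - Y. real (card (pat w))) \<le> (\<Sum>w\<in>X z - Y. (1 - \<eta>) * d * card J)"
    by (intro sum_mono) (auto simp: Y_def)
  moreover have "(\<Sum>w\<in>X z - Y. (1 - \<eta>) * d * card J) \<le> card (X z) * ((1 - \<eta>) * d * card J)"
    using \<eta> d0 finX by (simp add: mult_right_mono card_mono)
  ultimately have "card J * ((1 - \<eta> / 2) * d * card (X z)) \<le> card Y * card J + card (X z) * ((1 - \<eta>) * d * card J)"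
    using count by simp
  then have "card J * (\<eta> / 2 * d * card (X z)) \<le> card J * real (card Y)"
    by (simp add: algebra_simps)
  \<comment> \<open>The mean share of \<open>J\<close> is at least
    \<open>(1 - \<eta> / 2) * d\<close>, but at most \<open>(1 - \<eta>) * d\<close> outside
    \<open>Y\<close>. The difference must come from \<open>Y\<close>, where a share is at most
    1.\<close>
  then have Y: "\<eta> / 2 * d * card (X z) \<le> card Y" using J0 by simp
  have "\<eta> / 2 * q ^ card V * card (X z) \<le> \<eta> / 2 * d * card (X z)"
    unfolding d_def using q \<eta> back_deg_le[OF P]
    by (intro mult_right_mono mult_left_mono power_decreasing) auto
  then have "real (card J * 2 ^ card J) \<le> card Y" using big Y by simp
  then have large: "card J * card (Pow J) \<le> card Y" using finJ by (simp only: card_Pow of_nat_le_iff)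
  have "\<exists>J'\<in>pat ` Y. card J \<le> card {w\<in>Y. pat w = J'}"
  proof (rule ccontr)
    assume "\<not> ?thesis"
    then have less: "card {w\<in>Y. pat w = J'} < card J" if "J' \<in> pat ` Y" for J'
      using that by (auto simp: not_le)
    have sub: "pat ` Y \<subseteq> Pow J" by (auto simp: pat_def)
    have finI: "finite (pat ` Y)" using finY by simp
    have neY: "Y \<noteq> {}" using large J0 finJ by (auto simp: card_Pow)
    have "Y = (\<Union>J'\<in>pat ` Y. {w\<in>Y. pat w = J'})" by auto
    then have "card Y \<le> (\<Sum>J'\<in>pat ` Y. card {w\<in>Y. pat w = J'})"
      using card_UN_le[OF finI, of "\<lambda>J'. {w\<in>Y. pat w = J'}"] by simp
    also have "\<dots> < (\<Sum>J'\<in>pat ` Y. card J)"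
      using less finI neY by (intro sum_strict_mono) auto
    also have "\<dots> \<le> card (Pow J) * card J"
      using sub finJ by (simp add: card_mono)
    finally show False using large by (simp add: mult.commute)
  qed
  then obtain w0 where w0: "w0 \<in> Y" "card J \<le> card {w\<in>Y. pat w = pat w0}" by blast
  have J': "pat w0 \<subseteq> J" "(1 - \<eta>) * d * card J \<le> card (pat w0)"
    using w0 by (auto simp: pat_def Y_def)
  have "\<exists>x'. tuples (insert z P) (pat w0) x'"
  proof (rule tuples_extend_pattern[OF T z J'(1)])
    fix w assume w: "w \<in> {w\<in>Y. pat w = pat w0}"
    then have "w \<in> X z" "pat w0 = pat w" using finY by auto
    then show "w \<in> X z \<and> (\<forall>i\<in>pat w0. w \<in> cand P (x i) z - bad P (x i) z)"
      by (auto simp: pat_def)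
  next
    show "finite {w\<in>Y. pat w = pat w0}" using finY by simp
    show "card (pat w0) \<le> card {w\<in>Y. pat w = pat w0}"
      using w0(2) card_mono[OF finJ J'(1)] by linarith
  qed
  then show ?thesis using J' unfolding d_def by blast
qed

text \<open>Through this identity the losses \<open>q ^ back_deg P z\<close> multiply to a power of
  \<open>q\<close> that counts edges, whatever the order of the vertices.\<close>

lemma card_edges_insert:
  assumes P: "P \<subseteq> V" and z: "z \<in> V - P"
  shows "card {e\<in>Ed. e \<subseteq> insert z P} = card {e\<in>Ed. e \<subseteq> P} + back_deg P z"
proof -
  have "Ed \<subseteq> Pow V" using Ed by auto
  then have finE: "finite Ed" using finV finite_subset by blast
  have finP: "finite P" using finite_subset[OF P finV] .
  have "{e\<in>Ed. e \<subseteq> insert z P} = {e\<in>Ed. e \<subseteq> P} \<union> (\<lambda>u. {u, z}) ` {u\<in>P. {u, z} \<in> Ed}"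
  proof (intro equalityI subsetI)
    fix e assume e: "e \<in> {e\<in>Ed. e \<subseteq> insert z P}"
    show "e \<in> {e\<in>Ed. e \<subseteq> P} \<union> (\<lambda>u. {u, z}) ` {u\<in>P. {u, z} \<in> Ed}"
    proof (cases "z \<in> e")
      case True
      then obtain u where "e = {u, z}" "u \<noteq> z" using e Ed[of e] by (auto simp: card_2_iff)
      then show ?thesis using e by auto
    qed (use e in auto)
  qed auto
  moreover have "{e\<in>Ed. e \<subseteq> P} \<inter> (\<lambda>u. {u, z}) ` {u\<in>P. {u, z} \<in> Ed} = {}" using z by auto
  moreover have "inj_on (\<lambda>u. {u, z}) {u\<in>P. {u, z} \<in> Ed}"
    using z by (auto simp: inj_on_def doubleton_eq_iff)
  ultimately show ?thesis
    using finE finP by (simp add: card_Un_disjoint card_image back_deg_def)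
qed

end

context regular_system
begin

lemma finite_edges: "finite Ed"
proof (rule finite_subset)
  show "Ed \<subseteq> Pow V" using Ed by auto
qed (use finV in simp)

text \<open>The bound \<open>card J \<le> s\<close> is carried along because families only shrink,
  so the one size condition in terms of \<open>s\<close> serves every application of the pigeonhole
  principle.\<close>

lemma tuples_complete:
  assumes "tuples P J x" "card J \<le> s"
    and big: "\<And>z. s * 2 ^ s \<le> \<eta> / 2 * q ^ card V * card (X z)"
  shows "\<exists>J' x'. tuples V J' x' \<and>
    (1 - \<eta>) ^ card (V - P) * q ^ (card Ed - card {e\<in>Ed. e \<subseteq> P}) * card J \<le> card J'"
  using assms(1,2)
proof (induction "card (V - P)" arbitrary: P J x)
  case 0
  then have "P = V" using finV by (auto simp: tuples_def)
  moreover have "{e\<in>Ed. e \<subseteq> V} = Ed" using Ed by auto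
  ultimately show ?case using 0 by auto
next
  case (Suc m)
  then have "V - P \<noteq> {}" by force
  then obtain z where z: "z \<in> V - P" by blast
  have P: "P \<subseteq> V" using Suc.prems by (auto simp: tuples_def)
  have "card J * 2 ^ card J \<le> s * 2 ^ s"
    using Suc.prems by (intro mult_mono power_increasing) auto
  then have "real (card J * 2 ^ card J) \<le> real (s * 2 ^ s)" by (subst of_nat_le_iff)
  then have "card J * 2 ^ card J \<le> \<eta> / 2 * q ^ card V * card (X z)" using big[of z] by simp
  then obtain J1 x1 where 1: "J1 \<subseteq> J" "tuples (insert z P) J1 x1"
    "(1 - \<eta>) * q ^ back_deg P z * card J \<le> card J1"
    using tuples_step[OF Suc.prems(1) z] by auto
  have "V - insert z P = (V - P) - {z}" by auto
  then have m: "m = card (V - insert z P)" "card (V - P) = Suc m" using Suc.hyps(2) z finV by auto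
  have "finite J" using Suc.prems by (auto simp: tuples_def)
  then have "card J1 \<le> s" using card_mono[OF _ 1(1)] Suc.prems(2) by simp
  then obtain J' x' where J': "tuples V J' x'"
    "(1 - \<eta>) ^ m * q ^ (card Ed - card {e\<in>Ed. e \<subseteq> insert z P}) * card J1 \<le> card J'"
    using Suc.hyps(1)[OF m(1) 1(2)] m(1) by auto
  have c: "card {e\<in>Ed. e \<subseteq> insert z P} \<le> card Ed" using finite_edges by (intro card_mono) auto
  have "card Ed - card {e\<in>Ed. e \<subseteq> P} = (card Ed - card {e\<in>Ed. e \<subseteq> insert z P}) + back_deg P z"
    using c card_edges_insert[OF P z] by simp
  then have "(1 - \<eta>) ^ card (V - P) * q ^ (card Ed - card {e\<in>Ed. e \<subseteq> P}) * card J
    = (1 - \<eta>) ^ m * q ^ (card Ed - card {e\<in>Ed. e \<subseteq> insert z P}) * ((1 - \<eta>) * q ^ back_deg P z * card J)"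
    by (simp add: m power_add)
  also have "\<dots> \<le> (1 - \<eta>) ^ m * q ^ (card Ed - card {e\<in>Ed. e \<subseteq> insert z P}) * card J1"
    using 1(3) \<eta> q by (intro mult_left_mono) auto
  finally show ?case using J' by force
qed

text \<open>Using a biclique for the first edge costs a factor \<open>r ^ s\<close> in the size of the parts and no
  loss in \<open>s\<close>; this is why the exponent is \<open>|E(H)| - 1\<close>.\<close>

lemma tuples_initial:
  assumes ab: "{a, b} \<in> Ed" and s: "1 \<le> s"
    and big: "\<And>v. 2 * real s ^ 2 \<le> (1 - \<eta>) * q * card (X v)"
      "\<And>v. 4 * real s \<le> card (X v) * ((1 - \<eta>) * q) ^ s"
  shows "\<exists>x. tuples {a, b} {..<s} x"
proof -
  have abV: "a \<in> V" "b \<in> V" using Ed[OF ab] by auto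
  have neq: "a \<noteq> b" using ab not_loop by auto
  \<comment> \<open>Values outside the embedded set are never inspected, so any function represents
    the empty embedding.\<close>
  define x0 :: "'b \<Rightarrow> 'c" where "x0 = (\<lambda>_. undefined)"
  \<comment> \<open>\<open>E i j\<close> asks for more than the colour: sending \<open>a\<close> and
    \<open>b\<close> to \<open>i\<close> and \<open>j\<close> must be good. So any pairing of the
    two sides of a biclique yields good embeddings.\<close>
  define E where "E i j \<longleftrightarrow> i \<notin> bad {} x0 a \<and>
    j \<in> cand {a} (x0(a := i)) b - bad {a} (x0(a := i)) b" for i j
  have good0: "good {} x0" by (simp add: good_def cand_def back_deg_def)
  have good1: "good {a} (x0(a := i))" if "i \<in> X a - bad {} x0 a" for i
    using good_extend[OF _ good0 _ that] abV by simp
  have "{u \<in> {a}. {u, b} \<in> Ed} = {a}" using ab by auto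
  then have bd: "back_deg {a} b = 1" by (simp add: back_deg_def)
  have fin_bad: "finite (X a - bad {} x0 a)" using finX by simp
  have c0: "(1 - \<eta> / 2) * card (X a) \<le> card (X a - bad {} x0 a)"
    using card_good_cand_ge[OF _ good0, of a] abV by (simp add: cand_def back_deg_def)
  have "(1 - \<eta>) * q * card (X a) * card (X b)
      \<le> ((1 - \<eta> / 2) * card (X a)) * ((1 - \<eta> / 2) * q * card (X b))"
  proof -
    have "1 - \<eta> \<le> (1 - \<eta> / 2) * (1 - \<eta> / 2)"
      using one_minus_product_ge[of "\<eta> / 2" "\<eta> / 2"] \<eta> by simp
    then have "(1 - \<eta>) * (q * card (X a) * card (X b)) \<le>
      (1 - \<eta> / 2) * (1 - \<eta> / 2) * (q * card (X a) * card (X b))"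
      using q by (intro mult_right_mono) auto
    then show ?thesis by (simp add: mult_ac)
  qed
  also have "\<dots> \<le> card (X a - bad {} x0 a) * ((1 - \<eta> / 2) * q * card (X b))"
    using c0 \<eta> q by (intro mult_right_mono) auto
  also have "\<dots> = (\<Sum>i\<in>X a - bad {} x0 a. (1 - \<eta> / 2) * q * card (X b))" by simp
  also have "\<dots> \<le> (\<Sum>i\<in>X a - bad {} x0 a. \<Sum>j\<in>X b. of_bool (E i j))"
  proof (rule sum_mono)
    fix i assume i: "i \<in> X a - bad {} x0 a"
    have "{j\<in>X b. E i j} = cand {a} (x0(a := i)) b - bad {a} (x0(a := i)) b"
      using i cand_subset by (auto simp: E_def)
    then have "(1 - \<eta> / 2) * q * card (X b) \<le> card {j\<in>X b. E i j}"
      using card_good_cand_ge[OF _ good1[OF i], of b] abV neq bd by simp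
    then show "(1 - \<eta> / 2) * q * card (X b) \<le> (\<Sum>j\<in>X b. of_bool (E i j))"
      using finX by (simp add: Int_def)
  qed
  also have "\<dots> \<le> edge_count E (X a) (X b)"
    unfolding edge_count_def using finX by (intro sum_mono2) (auto intro: sum_nonneg)
  finally have dens: "(1 - \<eta>) * q * card (X a) * card (X b) \<le> edge_count E (X a) (X b)" .
  have \<beta>: "0 < (1 - \<eta>) * q" "(1 - \<eta>) * q \<le> 1" using q \<eta> by (auto intro: mult_le_one)
  have "real s * (2 * s) \<le> (1 - \<eta>) * q * card (X a)" using big(1)[of a] by (simp add: power2_eq_square)
  then have k: "s \<le> 1 / (2 * real s) * ((1 - \<eta>) * q) * card (X a)" using s by (simp add: field_simps)
  obtain A B where AB: "A \<subseteq> X a" "card A = s" "B \<subseteq> X b" "card B = s"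
    "\<And>x y. x \<in> A \<Longrightarrow> y \<in> B \<Longrightarrow> E x y"
  proof (rule biclique_exists[OF finX finX \<beta> dens s k, of s])
    show "real s * (1 / (2 * real s)) \<le> 1 / 2" using s by simp
    show "4 * real s \<le> card (X b) * ((1 - \<eta>) * q) ^ s" using big(2)[of b] by simp
  qed (simp, rule that, assumption+)
  have "finite A" "finite B" using AB finX finite_subset by metis+
  then obtain f g where f: "bij_betw f {..<s} A" and g: "bij_betw g {..<s} B"
    using ex_bij_betw_nat_finite AB(2,4) unfolding atLeast0LessThan by metis
  have fA: "f i \<in> A" "g i \<in> B" if "i < s" for i
    using f g that by (auto simp: bij_betw_def)
  define x where "x i = x0(a := f i, b := g i)" for i
  have Eij: "E (f i) (g j)" if "i < s" "j < s" for i j using AB(5) fA that by blast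
  have R: "R a b (f i) (g j)" if "i < s" "j < s" for i j
    using Eij[OF that] ab by (auto simp: E_def cand_def)
  have "tuples {a, b} {..<s} x"
    unfolding tuples_def
  proof (intro conjI ballI impI)
    fix i assume i: "i \<in> {..<s}"
    have "f i \<in> X a - bad {} x0 a" using Eij[of i i] i fA AB by (auto simp: E_def)
    then have "good {a} (x0(a := f i))" by (rule good1)
    then have "good (insert b {a}) (x i)"
      unfolding x_def using Eij[of i i] i abV neq cand_subset
      by (intro good_extend[of "{a}"]) (auto simp: E_def)
    then show "good {a, b} (x i)" by (simp add: insert_commute)
  next
    fix u assume "u \<in> {a, b}"
    then show "inj_on (\<lambda>i. x i u) {..<s}"
      using f g neq by (auto simp: x_def bij_betw_def)
  next
    fix u i assume "u \<in> {a, b}" "i \<in> {..<s}"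
    then show "x i u \<in> X u" using fA AB neq by (auto simp: x_def)
  next
    fix u v i j
    assume uv: "u \<in> {a, b}" "v \<in> {a, b}" "{u, v} \<in> Ed" and ij: "i \<in> {..<s}" "j \<in> {..<s}"
    then consider "u = a" "v = b" | "u = b" "v = a" using not_loop by auto
    then show "R u v (x i u) (x j v)"
    proof cases
      case 1
      then show ?thesis using R[of i j] ij neq by (simp add: x_def)
    next
      case 2
      then show ?thesis using R[of j i] ij neq by (simp add: x_def R_sym)
    qed
  qed (use abV in auto)
  then show ?thesis by blast
qed

lemma blowup_embedding:
  fixes s t :: nat
  assumes ne: "Ed \<noteq> {}" and s: "1 \<le> s"
    and big: "\<And>v. 2 * real s ^ 2 \<le> (1 - \<eta>) * q * card (X v)"
      "\<And>v. 4 * real s \<le> card (X v) * ((1 - \<eta>) * q) ^ s"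
      "\<And>v. real s * 2 ^ s \<le> \<eta> / 2 * q ^ card V * card (X v)"
    and t: "t \<le> (1 - \<eta>) ^ card V * q ^ (card Ed - 1) * s"
  shows "\<exists>f. (\<forall>v\<in>V. inj_on (f v) {..<t} \<and> f v ` {..<t} \<subseteq> X v) \<and>
    (\<forall>u v. {u, v} \<in> Ed \<longrightarrow> (\<forall>i<t. \<forall>j<t. R u v (f u i) (f v j)))"
proof -
  obtain e where "e \<in> Ed" using ne by blast
  moreover have "card e = 2" using \<open>e \<in> Ed\<close> Ed by blast
  ultimately obtain a b where ab: "{a, b} \<in> Ed" "a \<noteq> b" unfolding card_2_iff by blast
  obtain x where x: "tuples {a, b} {..<s} x" using tuples_initial[OF ab(1) s big(1,2)] by blast
  \<comment> \<open>Exactly one edge is already accounted for by the biclique, which gives the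
    exponent \<open>card Ed - 1\<close>.\<close>
  have "{e\<in>Ed. e \<subseteq> {a, b}} = {{a, b}}"
  proof (intro equalityI subsetI)
    fix e assume e: "e \<in> {e\<in>Ed. e \<subseteq> {a, b}}"
    then have "card e = card {a, b}" using Ed ab by auto
    then show "e \<in> {{a, b}}" using e card_subset_eq[of "{a, b}" e] by simp
  qed (use ab in auto)
  then have one: "card {e\<in>Ed. e \<subseteq> {a, b}} = 1" by simp
  obtain J y where J: "tuples V J y"
    "(1 - \<eta>) ^ card (V - {a, b}) * q ^ (card Ed - 1) * s \<le> card J"
    using tuples_complete[OF x _ big(3)] unfolding one by auto
  have "(1 - \<eta>) ^ card V \<le> (1 - \<eta>) ^ card (V - {a, b})"
    using \<eta> finV by (intro power_decreasing card_mono) auto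
  then have "(1 - \<eta>) ^ card V * q ^ (card Ed - 1) * s \<le> (1 - \<eta>) ^ card (V - {a, b}) * q ^ (card Ed - 1) * s"
    using q by (intro mult_right_mono) auto
  then have tJ: "t \<le> card J" using J(2) t by linarith
  have finJ: "finite J" using J by (simp add: tuples_def)
  obtain I where I: "I \<subseteq> J" "card I = t" using obtain_subset_with_card_n[OF tJ] by blast
  have "finite I" using finite_subset[OF I(1) finJ] .
  then obtain g where g: "bij_betw g {..<t} I"
    using ex_bij_betw_nat_finite I(2) unfolding atLeast0LessThan by metis
  have gJ: "g i \<in> J" if "i < t" for i using g I that by (auto simp: bij_betw_def)
  show ?thesis
  proof (intro exI[of _ "\<lambda>v i. y (g i) v"] conjI ballI allI impI)
    fix v assume v: "v \<in> V"
    have "inj_on (\<lambda>i. y i v) (g ` {..<t})"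
      using J(1) v gJ by (auto simp: tuples_def intro: inj_on_subset)
    then show "inj_on (\<lambda>i. y (g i) v) {..<t}"
      using g comp_inj_on[of g "{..<t}" "\<lambda>i. y i v"] by (simp add: bij_betw_def comp_def)
    show "(\<lambda>i. y (g i) v) ` {..<t} \<subseteq> X v" using J(1) v gJ by (auto simp: tuples_def)
  next
    fix u v i j assume uv: "{u, v} \<in> Ed" and "i < t" "j < t"
    then have "u \<in> V" "v \<in> V" "g i \<in> J" "g j \<in> J" using Ed[OF uv] gJ by auto
    then show "R u v (y (g i) u) (y (g j) v)" using J(1) uv unfolding tuples_def by blast
  qed
qed

end

subsection \<open>Blowup Ramsey numbers\<close>

text \<open>The left side tends to \<open>r powr (r ^ (m - 1))\<close> as \<open>\<eta>\<close>
  tends to 0 from the right, and \<open>m \<ge> 2\<close> makes this strictly smaller than the right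
  side. The exponents 4 and \<open>h + (m - 1)\<close> are those needed in
  \<open>sample_size_choice\<close>.\<close>

lemma parameter_choice:
  fixes r \<gamma> :: real
  assumes r: "2 \<le> r" and \<gamma>: "0 < \<gamma>" and m: "2 \<le> m"
  obtains \<eta> where "0 < \<eta>" "\<eta> < 1"
    "(r / (1 - \<eta>) ^ 4) powr (r ^ (m - 1) / (1 - \<eta>) ^ (h + (m - 1))) \<le> r powr ((r + \<gamma>) powr (real m - 1))"
proof -
  define f where "f \<eta> = (r / (1 - \<eta>) ^ 4) powr (r ^ (m - 1) / (1 - \<eta>) ^ (h + (m - 1)))" for \<eta> :: real
  have "(f \<longlongrightarrow> (r / (1 - 0) ^ 4) powr (r ^ (m - 1) / (1 - 0) ^ (h + (m - 1)))) (at_right 0)"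
    unfolding f_def using r by (intro tendsto_intros) auto
  then have lim: "(f \<longlongrightarrow> r powr (r ^ (m - 1))) (at_right 0)" by simp
  have "r ^ (m - 1) < (r + \<gamma>) ^ (m - 1)"
    using r \<gamma> m by (intro power_strict_mono) auto
  also have "\<dots> = (r + \<gamma>) powr (real m - 1)"
    using r \<gamma> m by (simp add: of_nat_diff flip: powr_realpow)
  finally have "r powr (r ^ (m - 1)) < r powr ((r + \<gamma>) powr (real m - 1))"
    using r by (intro powr_less_mono) auto
  then have "\<forall>\<^sub>F \<eta> in at_right 0. f \<eta> < r powr ((r + \<gamma>) powr (real m - 1))"
    using lim by (rule order_tendstoD(2)[rotated])
  moreover have "\<forall>\<^sub>F \<eta> in at_right 0. \<eta> < (1::real)"
    by (rule order_tendstoD(2)[OF tendsto_ident_at]) simp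
  moreover have "\<forall>\<^sub>F \<eta> in at_right 0. (0::real) < \<eta>" by (simp add: eventually_at_right_less)
  ultimately have "\<forall>\<^sub>F \<eta> in at_right 0. 0 < \<eta> \<and> \<eta> < 1 \<and> f \<eta> < r powr ((r + \<gamma>) powr (real m - 1))"
    by eventually_elim simp
  then obtain \<eta> where "0 < \<eta>" "\<eta> < 1" "f \<eta> < r powr ((r + \<gamma>) powr (real m - 1))"
    using eventually_happens' trivial_limit_at_right_real by blast
  then show thesis using that[of \<eta>] by (simp add: f_def)
qed

text \<open>The base \<open>B = r / (1 - \<eta>) ^ 4\<close> exceeds
  \<open>1 / \<beta> = r / (1 - \<eta>) ^ 2\<close>, and the \<open>s\<close>-th power of the
  quotient pays for the factors polynomial in \<open>s\<close>. With \<open>s\<close> about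
  \<open>t / \<sigma>\<close>, \<open>B ^ s\<close> is about
  \<open>(B powr (1 / \<sigma>)) ^ t\<close>, and \<open>B powr (1 / \<sigma>)\<close> is the
  quantity bounded by \<open>b\<close>.\<close>

lemma sample_size_choice:
  fixes \<eta> q r b :: real
  assumes r: "2 \<le> r" and \<eta>: "0 < \<eta>" "\<eta> < 1" and q: "q = (1 - \<eta>) * (1 / r)"
    and b: "(r / (1 - \<eta>) ^ 4) powr (r ^ M / (1 - \<eta>) ^ (h + M)) \<le> b"
  obtains K where "0 < K" "\<And>t. 1 \<le> t \<Longrightarrow> \<exists>s\<ge>1. real t \<le> (1 - \<eta>) ^ h * q ^ M * real s \<and>
    (\<forall>Z. K * b ^ t \<le> Z \<longrightarrow> 2 * real s ^ 2 \<le> (1 - \<eta>) * q * Z \<and> 4 * real s \<le> Z * ((1 - \<eta>) * q) ^ s \<and>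
      real s * 2 ^ s \<le> \<eta> / 2 * q ^ h * Z)"
proof -
  define \<beta> where "\<beta> = (1 - \<eta>) * q"
  define B where "B = r / (1 - \<eta>) ^ 4"
  define \<sigma> where "\<sigma> = (1 - \<eta>) ^ h * q ^ M"
  \<comment> \<open>Dominates the three coefficients with which \<open>s^2 / \<beta> ^ s\<close>
    occurs in the three size conditions.\<close>
  define K' where "K' = 2 / \<beta> + 4 + 2 / (\<eta> * q ^ h)"
  have q0: "0 < q" using r \<eta> by (simp add: q)
  have \<beta>: "0 < \<beta>" using q0 \<eta> by (simp add: \<beta>_def)
  \<comment> \<open>From \<open>r \<ge> 2\<close>; it bounds the \<open>2 ^ s\<close> of the
    pigeonhole by the \<open>1 / \<beta> ^ s\<close> of the biclique.\<close>
  have "\<beta> * 2 \<le> 1"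
  proof -
    have "\<beta> \<le> 1 * (1 * (1 / 2))" unfolding \<beta>_def q using \<eta> r by (intro mult_mono) auto
    then show ?thesis by simp
  qed
  have \<sigma>: "0 < \<sigma>" using q0 \<eta> by (simp add: \<sigma>_def)
  have K': "2 / \<beta> \<le> K'" "4 \<le> K'" "2 / (\<eta> * q ^ h) \<le> K'" "0 < K'"
    using \<beta> \<eta> q0 by (auto simp: K'_def add_pos_pos)
  have pow4: "(1 - \<eta>) ^ 4 \<le> 1" "0 < (1 - \<eta>) ^ 4" using \<eta> by (auto intro: power_le_one)
  then have "r * (1 - \<eta>) ^ 4 \<le> r * 1" using r by (intro mult_left_mono) auto
  then have B: "1 \<le> B" unfolding B_def using r pow4 by (simp add: le_divide_eq)
  have B\<beta>: "B * \<beta> = 1 / (1 - \<eta>) ^ 2"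
    using r \<eta> by (simp add: B_def \<beta>_def q power2_eq_square power4_eq_xxxx)
  have sq: "real s ^ 2 \<le> B ^ s * \<beta> ^ s / \<eta>\<^sup>2" for s
  proof -
    have "s * \<eta> \<le> (1 + \<eta>) ^ s" using Bernoulli_inequality[of \<eta> s] \<eta> by simp
    also have "\<dots> \<le> (1 / (1 - \<eta>)) ^ s"
    proof (rule power_mono)
      have "(1 + \<eta>) * (1 - \<eta>) \<le> 1" by (simp add: algebra_simps)
      then show "1 + \<eta> \<le> 1 / (1 - \<eta>)" using \<eta> by (simp add: le_divide_eq)
    qed (use \<eta> in simp)
    finally have "(s * \<eta>)\<^sup>2 \<le> ((1 / (1 - \<eta>)) ^ s)\<^sup>2" using \<eta> by (intro power_mono) auto
    also have "\<dots> = B ^ s * \<beta> ^ s"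
      by (simp add: B\<beta> power_divide flip: power_mult_distrib power_mult) (simp add: mult.commute)
    finally show ?thesis using \<eta> by (simp add: le_divide_eq power_mult_distrib)
  qed
  define K where "K = K' * B / \<eta>\<^sup>2"
  show thesis
  proof (rule that[of K])
    show "0 < K" using K' B \<eta> by (simp add: K_def)
    fix t :: nat assume t: "1 \<le> t"
    define s where "s = nat \<lceil>t / \<sigma>\<rceil>"
    have "0 < t / \<sigma>" using t \<sigma> by simp
    then have s: "t / \<sigma> \<le> s" "s \<le> t / \<sigma> + 1" "1 \<le> s" unfolding s_def by linarith+
    have "real t \<le> \<sigma> * s" using s(1) \<sigma> by (simp add: divide_le_eq mult.commute)
    moreover have "2 * real s ^ 2 \<le> \<beta> * Z \<and> 4 * real s \<le> Z * \<beta> ^ s \<and> real s * 2 ^ s \<le> \<eta> / 2 * q ^ h * Z"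
      if Z: "K * b ^ t \<le> Z" for Z
    proof -
      have "B ^ s = B powr s" using B by (simp add: powr_realpow)
      also have "\<dots> \<le> B powr (t / \<sigma> + 1)" using B s by (intro powr_mono) auto
      also have "\<dots> = B * (B powr (1 / \<sigma>)) powr t" using B by (simp add: powr_add powr_powr)
      also have "\<dots> = B * (B powr (1 / \<sigma>)) ^ t" using B by (simp add: powr_realpow)
      also have "\<dots> \<le> B * b ^ t"
      proof (intro mult_left_mono power_mono)
        have "1 / \<sigma> = r ^ M / (1 - \<eta>) ^ (h + M)"
          by (simp add: \<sigma>_def q power_mult_distrib power_divide power_add)
        then show "B powr (1 / \<sigma>) \<le> b" using b by (simp add: B_def)
      qed (use B in auto)
      finally have "K' / \<eta>\<^sup>2 * B ^ s \<le> K' / \<eta>\<^sup>2 * (B * b ^ t)" using K' by (intro mult_left_mono) auto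
      also have "\<dots> \<le> Z" using Z by (simp add: K_def)
      finally have Z': "K' / \<eta>\<^sup>2 * B ^ s \<le> Z" .
      have "K' * (real s ^ 2 / \<beta> ^ s) \<le> K' * (B ^ s / \<eta>\<^sup>2)"
      proof (intro mult_left_mono)
        show "real s ^ 2 / \<beta> ^ s \<le> B ^ s / \<eta>\<^sup>2" using sq[of s] \<beta> by (simp add: divide_le_eq mult_ac)
      qed (use K' in simp)
      with Z' have main: "K' * (real s ^ 2 / \<beta> ^ s) \<le> Z" by simp
      have \<beta>s: "0 < \<beta> ^ s" "\<beta> ^ s \<le> 1" using \<beta> \<open>\<beta> * 2 \<le> 1\<close> by (auto intro: power_le_one)
      have s1: "1 * real s \<le> real s ^ 2" unfolding power2_eq_square using s by (intro mult_right_mono) auto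
      have *: "C * (real s ^ 2 / \<beta> ^ s) \<le> Z" if "C \<le> K'" for C
      proof -
        have "C * (real s ^ 2 / \<beta> ^ s) \<le> K' * (real s ^ 2 / \<beta> ^ s)"
          using that \<beta>s by (intro mult_right_mono) auto
        then show ?thesis using main by linarith
      qed
      have "2 * real s ^ 2 \<le> \<beta> * Z"
      proof -
        have "real s ^ 2 * \<beta> ^ s \<le> real s ^ 2 * 1" using \<beta>s by (intro mult_left_mono) auto
        then have "real s ^ 2 \<le> real s ^ 2 / \<beta> ^ s" using \<beta>s by (simp add: le_divide_eq)
        then have "2 * real s ^ 2 \<le> 2 * (real s ^ 2 / \<beta> ^ s)" by simp
        also have "\<dots> = \<beta> * (2 / \<beta> * (real s ^ 2 / \<beta> ^ s))" using \<beta> by simp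
        also have "\<dots> \<le> \<beta> * Z" using *[OF K'(1)] \<beta> by (intro mult_left_mono) auto
        finally show ?thesis .
      qed
      moreover have "4 * real s \<le> Z * \<beta> ^ s"
      proof -
        have "4 * real s ^ 2 \<le> Z * \<beta> ^ s" using *[OF K'(2)] \<beta>s by (simp add: divide_le_eq)
        then show ?thesis using s1 by linarith
      qed
      moreover have "real s * 2 ^ s \<le> \<eta> / 2 * q ^ h * Z"
      proof -
        have "(\<beta> * 2) ^ s \<le> 1" using \<open>\<beta> * 2 \<le> 1\<close> \<beta> by (intro power_le_one) auto
        then have "2 ^ s \<le> 1 / \<beta> ^ s" using \<beta>s by (simp add: le_divide_eq power_mult_distrib mult.commute)
        then have "real s * 2 ^ s \<le> real s ^ 2 * (1 / \<beta> ^ s)" using s1 by (intro mult_mono) auto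
        also have "\<dots> = \<eta> / 2 * q ^ h * (2 / (\<eta> * q ^ h) * (real s ^ 2 / \<beta> ^ s))"
          using \<eta> q0 by simp
        also have "\<dots> \<le> \<eta> / 2 * q ^ h * Z" using *[OF K'(3)] \<eta> q0 by (intro mult_left_mono) auto
        finally show ?thesis .
      qed
      ultimately show ?thesis by blast
    qed
    ultimately show "\<exists>s\<ge>1. real t \<le> (1 - \<eta>) ^ h * q ^ M * real s \<and>
      (\<forall>Z. K * b ^ t \<le> Z \<longrightarrow> 2 * real s ^ 2 \<le> (1 - \<eta>) * q * Z \<and> 4 * real s \<le> Z * ((1 - \<eta>) * q) ^ s \<and>
        real s * 2 ^ s \<le> \<eta> / 2 * q ^ h * Z)"
      using s(3) unfolding \<sigma>_def \<beta>_def by blast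
  qed
qed

section \<open>Canonical copies and admissible part sizes\<close>

lemma simple_graphD:
  assumes "simple_graph G"
  shows "finite (verts G)" "finite (edges G)"
    "\<And>e. e \<in> edges G \<Longrightarrow> e \<subseteq> verts G \<and> card e = 2"
    "\<And>u v. {u, v} \<in> edges G \<Longrightarrow> u \<in> verts G \<and> v \<in> verts G \<and> u \<noteq> v"
proof -
  show 1: "finite (verts G)" and 2: "\<And>e. e \<in> edges G \<Longrightarrow> e \<subseteq> verts G \<and> card e = 2"
    using assms by (auto simp: simple_graph_def)
  have "edges G \<subseteq> Pow (verts G)" using 2 by auto
  then show "finite (edges G)" using 1 by (meson finite_Pow_iff finite_subset)
  fix u v assume "{u, v} \<in> edges G"
  then have "{u, v} \<subseteq> verts G" "card {u, v} = 2" using 2 by blast+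
  then show "u \<in> verts G \<and> v \<in> verts G \<and> u \<noteq> v" by auto
qed

definition admissible :: "nat \<Rightarrow> 'a ugraph \<Rightarrow> 'b ugraph \<Rightarrow> nat \<Rightarrow> nat \<Rightarrow> bool" where
  "admissible r G H t n \<longleftrightarrow> (\<forall>c. edge_coloring r (blowup G n) c \<longrightarrow>
     (\<exists>\<psi>. canonical_copy \<psi> H t G n \<and> monochromatic c \<psi> (blowup H t)))"

lemma canonical_copy_exists:
  assumes H: "simple_graph H" and \<phi>: "copy_of \<phi> H G"
    and f: "\<And>v. v \<in> verts H \<Longrightarrow> inj_on (f v) {..<t} \<and> f v ` {..<t} \<subseteq> {..<n}"
    and mono: "\<And>u v i j. {u, v} \<in> edges H \<Longrightarrow> i < t \<Longrightarrow> j < t \<Longrightarrow> c {(\<phi> u, f u i), (\<phi> v, f v j)} = k"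
  shows "\<exists>\<psi>. canonical_copy \<psi> H t G n \<and> monochromatic c \<psi> (blowup H t)"
proof -
  define \<psi> where "\<psi> = (\<lambda>(v, i). (\<phi> v, f v i))"
  have inj: "inj_on \<phi> (verts H)" and im: "\<phi> ` verts H \<subseteq> verts G"
    and ed: "\<And>e. e \<in> edges H \<Longrightarrow> \<phi> ` e \<in> edges G"
    using \<phi> by (auto simp: copy_of_def)
  have "copy_of \<psi> (blowup H t) (blowup G n)"
    unfolding copy_of_def
  proof (intro conjI ballI)
    show "inj_on \<psi> (verts (blowup H t))"
    proof (rule inj_onI)
      fix x y assume xy: "x \<in> verts (blowup H t)" "y \<in> verts (blowup H t)" "\<psi> x = \<psi> y"
      obtain u i v j where "x = (u, i)" "y = (v, j)" by (cases x, cases y)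
      then have *: "u \<in> verts H" "v \<in> verts H" "i \<in> {..<t}" "j \<in> {..<t}" "\<phi> u = \<phi> v" "f u i = f v j"
        using xy by (auto simp: blowup_def \<psi>_def)
      then have "u = v" using inj by (auto dest: inj_onD)
      moreover have "i = j" using * f[of u] \<open>u = v\<close> by (auto dest: inj_onD)
      ultimately show "x = y" using \<open>x = (u, i)\<close> \<open>y = (v, j)\<close> by simp
    qed
    show "\<psi> ` verts (blowup H t) \<subseteq> verts (blowup G n)"
      using im f by (fastforce simp: blowup_def \<psi>_def)
    fix e assume "e \<in> edges (blowup H t)"
    then obtain u v i j where e: "e = {(u, i), (v, j)}" "{u, v} \<in> edges H" "i < t" "j < t"
      by (auto simp: blowup_def)
    have "{\<phi> u, \<phi> v} \<in> edges G" using ed[OF e(2)] by simp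
    moreover have "u \<in> verts H" "v \<in> verts H" using simple_graphD(4)[OF H e(2)] by auto
    then have "f u i < n" "f v j < n" using f[of u] f[of v] e by auto
    ultimately show "\<psi> ` e \<in> edges (blowup G n)" by (auto simp: blowup_def \<psi>_def e(1))
  qed
  moreover have "monochromatic c \<psi> (blowup H t)"
    unfolding monochromatic_def
  proof (intro exI[of _ k] ballI)
    fix e assume "e \<in> edges (blowup H t)"
    then obtain u v i j where "e = {(u, i), (v, j)}" "{u, v} \<in> edges H" "i < t" "j < t"
      by (auto simp: blowup_def)
    then show "c (\<psi> ` e) = k" using mono by (simp add: \<psi>_def)
  qed
  ultimately show ?thesis
    unfolding canonical_copy_def using \<phi> by (intro exI[of _ \<psi>]) (auto simp: \<psi>_def)
qed

lemma blowup_coloring_less: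
  assumes "edge_coloring r (blowup G n) c" "{u, v} \<in> edges G" "i < n" "j < n"
  shows "c {(u, i), (v, j)} < r"
proof -
  have "{(u, i), (v, j)} \<in> edges (blowup G n)"
    unfolding blowup_def ugraph.simps using assms by blast
  then show ?thesis using assms(1) by (simp add: edge_coloring_def)
qed

lemma arrowsE:
  assumes "arrows r G H" "\<And>e. e \<in> edges G \<Longrightarrow> k e < r"
  obtains \<phi> k0 where "copy_of \<phi> H G" "\<And>u v. {u, v} \<in> edges H \<Longrightarrow> {\<phi> u, \<phi> v} \<in> edges G \<and> k {\<phi> u, \<phi> v} = k0"
proof -
  obtain \<phi> where \<phi>: "copy_of \<phi> H G" "monochromatic k \<phi> H"
    using assms unfolding arrows_def edge_coloring_def by blast
  then obtain k0 where k0: "\<And>e. e \<in> edges H \<Longrightarrow> k (\<phi> ` e) = k0" by (auto simp: monochromatic_def)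
  have "{\<phi> u, \<phi> v} \<in> edges G \<and> k {\<phi> u, \<phi> v} = k0" if "{u, v} \<in> edges H" for u v
    using \<phi>(1) k0[OF that] that by (force simp: copy_of_def)
  then show thesis by (rule that[OF \<phi>(1)])
qed

lemma admissible_no_edges:
  assumes H: "simple_graph H" and ar: "arrows r G H" and r: "0 < r" and E: "edges H = {}"
    and n: "t \<le> n"
  shows "admissible r G H t n"
  unfolding admissible_def
proof (intro allI impI)
  fix c
  \<comment> \<open>Without edges any copy is monochromatic, so a constant colouring of
    \<open>G\<close> suffices to extract one from \<open>arrows\<close>.\<close>
  obtain \<phi> where "copy_of \<phi> H G" by (rule arrowsE[OF ar, of "\<lambda>_. 0"]) (use r in auto)
  then show "\<exists>\<psi>. canonical_copy \<psi> H t G n \<and> monochromatic c \<psi> (blowup H t)"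
    using n E by (intro canonical_copy_exists[OF H, where f = "\<lambda>_ i. i"]) auto
qed

text \<open>Passing to regular subsets would lower the density to \<open>(1 - \<eta>) / r\<close>
  and thus spoil the base \<open>r\<close>. Instead each edge of \<open>G\<close> receives a colour
  of density at least \<open>1 / r\<close> between the full parts, and \<open>biclique_sharp\<close>
  applies with \<open>p = 1 / r\<close>.\<close>

lemma admissible_one_edge:
  assumes H: "simple_graph H" and G: "simple_graph G" and ar: "arrows r G H" and r: "2 \<le> r"
    and E: "card (edges H) = 1" and t: "1 \<le> t" and n: "2 ^ 30 * real r ^ t \<le> real n"
  shows "admissible r G H t n"
  unfolding admissible_def
proof (intro allI impI)
  fix c assume c: "edge_coloring r (blowup G n) c"
  have "\<exists>k<r. \<forall>u v. {u, v} = e \<longrightarrow>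
      1 / r * card {..<n} * card {..<n} \<le> edge_count (\<lambda>i j. c {(u, i), (v, j)} = k) {..<n} {..<n}"
    if e: "e \<in> edges G" for e
  proof -
    have "card e = 2" using simple_graphD(3)[OF G e] by simp
    then obtain a b where ab: "e = {a, b}" by (auto simp: card_2_iff)
    have "c {(a, i), (b, j)} < r" if "i \<in> {..<n}" "j \<in> {..<n}" for i j
      using blowup_coloring_less[OF c] e ab that by simp
    then obtain k where k: "k < r"
      "1 / r * card {..<n} * card {..<n} \<le> edge_count (\<lambda>i j. c {(a, i), (b, j)} = k) {..<n} {..<n}"
      using popular_colour[of r "{..<n}" "{..<n}" "\<lambda>i j. c {(a, i), (b, j)}"] r by auto
    have "edge_count (\<lambda>i j. c {(b, i), (a, j)} = k) {..<n} {..<n}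
        = edge_count (\<lambda>i j. c {(a, i), (b, j)} = k) {..<n} {..<n}"
      by (subst edge_count_swap[symmetric]) (simp add: insert_commute)
    then show ?thesis using k ab by (intro exI[of _ k]) (auto simp: doubleton_eq_iff)
  qed
  then obtain k where k: "\<And>e. e \<in> edges G \<Longrightarrow> k e < r"
    "\<And>u v. {u, v} \<in> edges G \<Longrightarrow> 1 / r * card {..<n} * card {..<n}
      \<le> edge_count (\<lambda>i j. c {(u, i), (v, j)} = k {u, v}) {..<n} {..<n}"
    by metis
  obtain \<phi> k0 where \<phi>: "copy_of \<phi> H G"
    "\<And>u v. {u, v} \<in> edges H \<Longrightarrow> {\<phi> u, \<phi> v} \<in> edges G \<and> k {\<phi> u, \<phi> v} = k0"
    by (rule arrowsE[OF ar k(1)]) (assumption, rule that)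
  obtain e where e: "edges H = {e}" using E by (auto simp: card_1_singleton_iff)
  then have "card e = 2" using simple_graphD(3)[OF H, of e] by simp
  then obtain a b where ab: "e = {a, b}" "a \<noteq> b" by (auto simp: card_2_iff)
  have dens: "1 / r * card {..<n} * card {..<n}
      \<le> edge_count (\<lambda>i j. c {(\<phi> a, i), (\<phi> b, j)} = k0) {..<n} {..<n}"
    using \<phi>(2)[of a b] k(2)[of "\<phi> a" "\<phi> b"] e ab by auto
  have "2 ^ 30 \<le> real n * (1 / r) ^ t"
    using n r by (simp add: power_divide le_divide_eq)
  then have "\<exists>A B. A \<subseteq> {..<n} \<and> card A = t \<and> B \<subseteq> {..<n} \<and> card B = t \<and>
      (\<forall>i\<in>A. \<forall>j\<in>B. c {(\<phi> a, i), (\<phi> b, j)} = k0)"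
    using r t by (intro biclique_sharp[OF _ _ _ _ dens]) (auto simp: field_simps)
  then obtain A B where AB: "A \<subseteq> {..<n}" "card A = t" "B \<subseteq> {..<n}" "card B = t"
    "\<And>i j. i \<in> A \<Longrightarrow> j \<in> B \<Longrightarrow> c {(\<phi> a, i), (\<phi> b, j)} = k0" by blast
  have "finite A" "finite B" using finite_subset[OF AB(1)] finite_subset[OF AB(3)] by auto
  then obtain g h where g: "bij_betw g {..<t} A" and h: "bij_betw h {..<t} B"
    using ex_bij_betw_nat_finite AB(2,4) unfolding atLeast0LessThan by metis
  have tn: "t \<le> n" using card_mono[OF _ AB(1)] AB(2) by simp
  define f where "f = (\<lambda>_. id)(a := g, b := h)"
  show "\<exists>\<psi>. canonical_copy \<psi> H t G n \<and> monochromatic c \<psi> (blowup H t)"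
  proof (rule canonical_copy_exists[OF H \<phi>(1), where f = f])
    fix v
    show "inj_on (f v) {..<t} \<and> f v ` {..<t} \<subseteq> {..<n}"
      using g h AB tn by (auto simp: f_def bij_betw_def)
  next
    fix u v i j assume uv: "{u, v} \<in> edges H" and ij: "i < t" "j < t"
    have gh: "g i \<in> A" "h i \<in> B" "g j \<in> A" "h j \<in> B"
      using g h ij by (auto simp: bij_betw_def)
    consider "u = a" "v = b" | "u = b" "v = a" using uv e ab by (auto simp: doubleton_eq_iff)
    then show "c {(\<phi> u, f u i), (\<phi> v, f v j)} = k0"
    proof cases
      case 1
      then show ?thesis using AB(5) gh ab by (simp add: f_def)
    next
      case 2
      then show ?thesis using AB(5)[of "g j" "h i"] gh ab by (simp add: f_def insert_commute)
    qed
  qed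
qed

lemma admissible_many_edges:
  fixes G :: "'a ugraph" and H :: "'b ugraph"
  assumes H: "simple_graph H" and G: "simple_graph G" and ar: "arrows r G H" and r: "2 \<le> r"
    and \<gamma>: "0 < \<gamma>" and m: "2 \<le> card (edges H)"
    and b: "b = real r powr ((real r + \<gamma>) powr (real (card (edges H)) - 1))"
  shows "\<exists>K>0. \<forall>t\<ge>1. \<forall>n\<ge>1. K * b ^ t \<le> real n \<longrightarrow> admissible r G H t n"
proof -
  let ?h = "card (verts H)" and ?m = "card (edges H)"
  obtain \<eta> where \<eta>: "0 < \<eta>" "\<eta> < 1"
    and \<eta>b: "(real r / (1 - \<eta>) ^ 4) powr (real r ^ (?m - 1) / (1 - \<eta>) ^ (?h + (?m - 1))) \<le> b"
    using parameter_choice[of "real r" \<gamma> ?m ?h] r \<gamma> m unfolding b by auto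
  define q where "q = (1 - \<eta>) * (1 / real r)"
  have q: "0 < q" "q \<le> 1" using \<eta> r by (auto simp: q_def divide_simps)
  define \<epsilon> where "\<epsilon> = \<eta> / 2 * q ^ ?h / (?h + 1)"
  have "\<eta> / 2 * q ^ ?h \<le> 1 * 1" using \<eta> q by (intro mult_mono power_le_one) auto
  then have \<epsilon>: "0 < \<epsilon>" "\<epsilon> \<le> 1" using \<eta> q by (auto simp: \<epsilon>_def divide_simps)
  have "?h * \<epsilon> = \<eta> / 2 * q ^ ?h * (?h / (?h + 1))" by (simp add: \<epsilon>_def)
  also have "\<dots> \<le> \<eta> / 2 * q ^ ?h * 1" using \<eta> q by (intro mult_left_mono) auto
  finally have h\<epsilon>: "?h * \<epsilon> \<le> \<eta> / 2 * q ^ ?h" by simp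
  obtain l where l: "0 < l" and reg: "\<forall>n\<ge>1. \<forall>c.
    (\<forall>u v i j. {u, v} \<in> edges G \<longrightarrow> i < n \<longrightarrow> j < n \<longrightarrow> c {(u, i), (v, j)} < r) \<longrightarrow>
    (\<exists>W k. (\<forall>v. W v \<subseteq> {..<n} \<and> l * real n \<le> card (W v)) \<and> (\<forall>e\<in>edges G. k e < r) \<and>
      (\<forall>u v. {u, v} \<in> edges G \<longrightarrow>
        lower_regular \<epsilon> ((1 - \<eta>) * (1 / r)) (\<lambda>i j. c {(u, i), (v, j)} = k {u, v}) (W u) (W v)))"
    using edgewise_lower_regular[of "edges G" r \<eta> \<epsilon>] simple_graphD[OF G] r \<eta> \<epsilon> by auto
  obtain K where K: "0 < K" "\<And>t. 1 \<le> t \<Longrightarrow> \<exists>s\<ge>1. real t \<le> (1 - \<eta>) ^ ?h * q ^ (?m - 1) * real s \<and>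
    (\<forall>Z. K * b ^ t \<le> Z \<longrightarrow> 2 * real s ^ 2 \<le> (1 - \<eta>) * q * Z \<and> 4 * real s \<le> Z * ((1 - \<eta>) * q) ^ s \<and>
      real s * 2 ^ s \<le> \<eta> / 2 * q ^ ?h * Z)"
  proof (rule sample_size_choice[OF _ \<eta> q_def \<eta>b])
    show "2 \<le> real r" using r by simp
  qed (rule that)
  show ?thesis
  \<comment> \<open>Regular subsets keep at least \<open>l * n\<close> vertices, so dividing by
    \<open>l\<close> leaves \<open>K * b ^ t\<close> in each of them.\<close>
  proof (intro exI[of _ "K / l"] conjI allI impI)
    show "0 < K / l" using K l by simp
    fix t n :: nat assume t: "1 \<le> t" and n: "1 \<le> n" "K / l * b ^ t \<le> real n"
    obtain s where s: "1 \<le> s" "real t \<le> (1 - \<eta>) ^ ?h * q ^ (?m - 1) * real s"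
      "\<And>Z. K * b ^ t \<le> Z \<Longrightarrow> 2 * real s ^ 2 \<le> (1 - \<eta>) * q * Z \<and> 4 * real s \<le> Z * ((1 - \<eta>) * q) ^ s \<and>
        real s * 2 ^ s \<le> \<eta> / 2 * q ^ ?h * Z"
      using K(2)[OF t] by blast
    show "admissible r G H t n"
      unfolding admissible_def
    proof (intro allI impI)
      fix c assume c: "edge_coloring r (blowup G n) c"
      have c': "\<forall>u v i j. {u, v} \<in> edges G \<longrightarrow> i < n \<longrightarrow> j < n \<longrightarrow> c {(u, i), (v, j)} < r"
        using blowup_coloring_less[OF c] by blast
      obtain W k where W: "\<forall>v. W v \<subseteq> {..<n} \<and> l * real n \<le> card (W v)" and k: "\<forall>e\<in>edges G. k e < r"
        and Wreg: "\<forall>u v. {u, v} \<in> edges G \<longrightarrow>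
          lower_regular \<epsilon> ((1 - \<eta>) * (1 / r)) (\<lambda>i j. c {(u, i), (v, j)} = k {u, v}) (W u) (W v)"
        using mp[OF spec[OF mp[OF spec[OF reg] n(1)]] c'] by (elim exE conjE)
      obtain \<phi> k0 where \<phi>: "copy_of \<phi> H G"
        "\<And>u v. {u, v} \<in> edges H \<Longrightarrow> {\<phi> u, \<phi> v} \<in> edges G \<and> k {\<phi> u, \<phi> v} = k0"
      proof (rule arrowsE[OF ar, of k])
        show "k e < r" if "e \<in> edges G" for e using k that by blast
      qed (rule that)
      define X where "X v = W (\<phi> v)" for v
      define R where "R u v i j \<longleftrightarrow> c {(\<phi> u, i), (\<phi> v, j)} = k0" for u v i j
      have "K * b ^ t \<le> l * real n" using n(2) l by (simp add: field_simps)
      then have big: "K * b ^ t \<le> card (X v)" for v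
        using W unfolding X_def by (meson order_trans)
      interpret regular_system "verts H" "edges H" X R q \<epsilon> \<eta>
      proof
        show "finite (verts H)" using simple_graphD[OF H] by simp
        show "e \<subseteq> verts H \<and> card e = 2" if "e \<in> edges H" for e using simple_graphD[OF H] that by simp
        show "finite (X v)" for v using W finite_subset unfolding X_def by (metis finite_lessThan)
        show "X v \<noteq> {}" for v
        proof
          assume "X v = {}"
          then have "l * real n \<le> 0" using W unfolding X_def by (metis card.empty of_nat_0)
          then show False using l n(1) by (simp add: mult_le_0_iff)
        qed
        show "R v u j i" if "R u v i j" for u v i j using that by (simp add: R_def insert_commute)
        show "lower_regular \<epsilon> q (R u v) (X u) (X v)" if "{u, v} \<in> edges H" for u v
        proof -
          have "{\<phi> u, \<phi> v} \<in> edges G" "k {\<phi> u, \<phi> v} = k0" using \<phi>(2)[OF that] by auto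
          then show ?thesis using Wreg unfolding R_def X_def q_def by metis
        qed
      qed (use q \<eta> \<epsilon> h\<epsilon> in auto)
      have "edges H \<noteq> {}" using m by auto
      then obtain f where f: "\<forall>v\<in>verts H. inj_on (f v) {..<t} \<and> f v ` {..<t} \<subseteq> X v"
        "\<forall>u v. {u, v} \<in> edges H \<longrightarrow> (\<forall>i<t. \<forall>j<t. R u v (f u i) (f v j))"
        using blowup_embedding[of s t] s big by blast
      show "\<exists>\<psi>. canonical_copy \<psi> H t G n \<and> monochromatic c \<psi> (blowup H t)"
      proof (rule canonical_copy_exists[OF H \<phi>(1), where f = f and k = k0])
        show "inj_on (f v) {..<t} \<and> f v ` {..<t} \<subseteq> {..<n}" if "v \<in> verts H" for v
          using f(1) that W unfolding X_def by blast
        show "c {(\<phi> u, f u i), (\<phi> v, f v j)} = k0" if "{u, v} \<in> edges H" "i < t" "j < t" for u v i j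
          using f(2) that unfolding R_def by blast
      qed
    qed
  qed
qed

lemma admissible_exists:
  fixes G :: "'a ugraph" and H :: "'b ugraph"
  assumes H: "simple_graph H" and G: "simple_graph G" and ar: "arrows r G H" and r: "2 \<le> r"
    and \<gamma>: "0 < \<gamma>"
    and b: "b = real r powr ((real r + \<gamma>) powr (real (card (edges H)) - 1))"
  shows "\<exists>K>0. \<forall>t\<ge>1. \<forall>n\<ge>1. K * b ^ t \<le> real n \<longrightarrow> admissible r G H t n"
proof -
  consider "card (edges H) = 0" | "card (edges H) = 1" | "2 \<le> card (edges H)" by linarith
  then show ?thesis
  proof cases
    case 1
    then have E: "edges H = {}" using simple_graphD(2)[OF H] by simp
    \<comment> \<open>The real exponent is \<open>-1\<close> here, so \<open>b\<close> is only
      \<open>r powr (1 / (r + \<gamma>))\<close>. This still exceeds 1, and Bernoulli makes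
      \<open>b ^ t / (b - 1)\<close> at least \<open>t\<close>.\<close>
    have "0 < (real r + \<gamma>) powr (real (card (edges H)) - 1)" using r \<gamma> by simp
    then have "real r powr 0 < b" unfolding b using r by (intro powr_less_mono) auto
    then have b1: "1 < b" using r by simp
    show ?thesis
    proof (intro exI[of _ "1 / (b - 1)"] conjI allI impI)
      show "0 < 1 / (b - 1)" using b1 by simp
      fix t n :: nat assume n: "1 / (b - 1) * b ^ t \<le> real n"
      have "t * (b - 1) \<le> b ^ t" using Bernoulli_inequality[of "b - 1" t] b1 by simp
      then have "t \<le> 1 / (b - 1) * b ^ t" using b1 by (simp add: le_divide_eq)
      then have "real t \<le> real n" using n by linarith
      then show "admissible r G H t n" using r by (intro admissible_no_edges[OF H ar _ E]) auto
    qed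
  next
    case 2
    then have "b = r" using b r \<gamma> by simp
    then show ?thesis
      using admissible_one_edge[OF H G ar r 2] by (intro exI[of _ "2 ^ 30"]) auto
  next
    case 3
    then show ?thesis using admissible_many_edges[OF H G ar r \<gamma> _ b] by simp
  qed
qed

lemma blowup_ramsey_le:
  assumes "admissible r G H t n" "1 \<le> n"
  shows "blowup_ramsey r G H t \<le> enat n"
  unfolding blowup_ramsey_def using assms by (intro Inf_lower) (auto simp: admissible_def)

lemma blowup_ramsey_exponential:
  fixes G :: "'a ugraph" and H :: "'b ugraph"
  assumes "simple_graph H" "simple_graph G" "arrows r G H" and r: "2 \<le> r" and "0 < \<gamma>"
    and b: "b = real r powr ((real r + \<gamma>) powr (real (card (edges H)) - 1))"
  shows "\<exists>a0. \<forall>a\<ge>a0. \<forall>t\<ge>1. ereal_of_enat (blowup_ramsey r G H t) \<le> ereal (a * b ^ t)"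
proof -
  obtain K where K: "0 < K" "\<And>t n. 1 \<le> t \<Longrightarrow> 1 \<le> n \<Longrightarrow> K * b ^ t \<le> real n \<Longrightarrow> admissible r G H t n"
    using admissible_exists[OF assms] by blast
  have b1: "1 \<le> b" unfolding b using r by (intro ge_one_powr_ge_zero) auto
  show ?thesis
  \<comment> \<open>Rounding up to an integer adds at most 1, which is at most \<open>b ^ t\<close>
    as \<open>b \<ge> 1\<close>.\<close>
  proof (intro exI[of _ "K + 1"] allI impI)
    fix a :: real and t :: nat assume a: "K + 1 \<le> a" and t: "1 \<le> t"
    define n where "n = nat \<lceil>K * b ^ t\<rceil>"
    have pos: "0 < K * b ^ t" using K b1 by simp
    have n: "K * b ^ t \<le> n" "n \<le> K * b ^ t + 1" "1 \<le> n" using pos unfolding n_def by linarith+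
    have "n \<le> K * b ^ t + 1 * b ^ t" using n one_le_power[OF b1, of t] by simp
    also have "\<dots> = (K + 1) * b ^ t" by (simp add: distrib_right)
    also have "\<dots> \<le> a * b ^ t" using a b1 by (intro mult_right_mono) auto
    finally have "real n \<le> a * b ^ t" .
    moreover have "blowup_ramsey r G H t \<le> enat n" using blowup_ramsey_le K(2)[OF t n(3,1)] n by blast
    then have "ereal_of_enat (blowup_ramsey r G H t) \<le> ereal_of_enat (enat n)"
      by (subst ereal_of_enat_le_iff)
    then have "ereal_of_enat (blowup_ramsey r G H t) \<le> ereal (real n)" by simp
    ultimately show "ereal_of_enat (blowup_ramsey r G H t) \<le> ereal (a * b ^ t)"
      using order_trans by fastforce
  qed
qed

theorem theorem1p3:
  fixes r :: nat
  assumes "r \<ge> 2"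
  shows
    "(\<forall>H :: 'b ugraph. simple_graph H \<longrightarrow>
        (\<exists>b :: real. \<forall>G :: 'a ugraph. simple_graph G \<and> arrows r G H \<longrightarrow>
          (\<exists>a :: real. \<forall>t \<ge> 1.
             ereal_of_enat (blowup_ramsey r G H t) \<le> ereal (a * b ^ t))))
     \<and>
     (\<exists>\<gamma>0 :: real. \<gamma>0 > 0 \<and> (\<forall>\<gamma>. 0 < \<gamma> \<and> \<gamma> < \<gamma>0 \<longrightarrow>
        (\<forall>(H :: 'b ugraph) (G :: 'a ugraph).
           simple_graph H \<and> simple_graph G \<and> arrows r G H \<longrightarrow>
           (\<exists>a0 :: real. \<forall>a \<ge> a0. \<forall>t \<ge> 1.
              ereal_of_enat (blowup_ramsey r G H t)
                \<le> ereal (a * (real r powr ((real r + \<gamma>) powr (real (card (edges H)) - 1))) ^ t)))))"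
proof (intro conjI)
  show "\<forall>H :: 'b ugraph. simple_graph H \<longrightarrow>
        (\<exists>b :: real. \<forall>G :: 'a ugraph. simple_graph G \<and> arrows r G H \<longrightarrow>
          (\<exists>a :: real. \<forall>t \<ge> 1.
             ereal_of_enat (blowup_ramsey r G H t) \<le> ereal (a * b ^ t)))"
  proof (intro allI impI)
    fix H :: "'b ugraph" assume H: "simple_graph H"
    \<comment> \<open>Fixing \<gamma> as 1 determines \<open>b\<close> from \<open>H\<close> and
      \<open>r\<close> before \<open>G\<close> is given.\<close>
    define b where "b = real r powr ((real r + 1) powr (real (card (edges H)) - 1))"
    have "\<exists>a :: real. \<forall>t \<ge> 1. ereal_of_enat (blowup_ramsey r G H t) \<le> ereal (a * b ^ t)"
      if "simple_graph G \<and> arrows r G H" for G :: "'a ugraph"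
      using blowup_ramsey_exponential[OF H _ _ assms zero_less_one b_def, of G] that by blast
    then show "\<exists>b :: real. \<forall>G :: 'a ugraph. simple_graph G \<and> arrows r G H \<longrightarrow>
          (\<exists>a :: real. \<forall>t \<ge> 1. ereal_of_enat (blowup_ramsey r G H t) \<le> ereal (a * b ^ t))"
      by blast
  qed
next
  show "\<exists>\<gamma>0 :: real. \<gamma>0 > 0 \<and> (\<forall>\<gamma>. 0 < \<gamma> \<and> \<gamma> < \<gamma>0 \<longrightarrow>
        (\<forall>(H :: 'b ugraph) (G :: 'a ugraph).
           simple_graph H \<and> simple_graph G \<and> arrows r G H \<longrightarrow>
           (\<exists>a0 :: real. \<forall>a \<ge> a0. \<forall>t \<ge> 1.
              ereal_of_enat (blowup_ramsey r G H t)
                \<le> ereal (a * (real r powr ((real r + \<gamma>) powr (real (card (edges H)) - 1))) ^ t))))"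
    using blowup_ramsey_exponential[OF _ _ _ assms _ refl] by (intro exI[of _ 1]) auto
qed

end
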